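(* Let $\mathcal{S}$ be a triangulated category containing all set-indexed coproducts, let $(\mathcal{P},\mathcal{I})$ be a (stable) projective class in $\mathcal{S}$, and let $X$ be an object of $\mathcal{S}$. If $X$ has length at most $n$, then for each $Y$ the Adams spectral sequence abutting to $\mathcal{S}(X,Y)$ collapses at $E_{n+1}$ and has $E_{n+1}=E_\infty$ concentrated in the first $n$ rows. If the projective class generates and $\mathcal{I}$ is closed under countable coproducts, then the converse holds (that is, if for each $Y$ the Adams spectral sequence abutting to $\mathcal{S}(X,Y)$ collapses at $E_{n+1}$ with $E_{n+1}=E_\infty$ concentrated in the first $n$ rows, then $X$ has length at most $n$), and the spectral sequence converges strongly.
   Context: Cofibre sequence means exact triangle. For a class $\mathcal{P}$ of objects, $\mathcal{P}\text{-null}$ is the class of maps $X\to Y$ such that every composite $P\to X\to Y$ with $P$ in $\mathcal{P}$ is zero; for a class $\mathcal{I}$ of maps, $\mathcal{I}\text{-proj}$ is the class of objects $P$ such that every composite $P\to X\to Y$ with $X\to Y$ in $\mathcal{I}$ is zero. A projective class is a pair $(\mathcal{P},\mathcal{I})$ with $\mathcal{P}\text{-null}=\mathcal{I}$, $\mathcal{I}\text{-proj}=\mathcal{P}$, such that each object $X$ lies in a cofibre sequence $P\to X\to Y$ with $P$ in $\mathcal{P}$ and $X\to Y$ in $\mathcal{I}$. It is stable if $\mathcal{P}$ and $\mathcal{I}$ are closed under suspension and desuspension. It generates if for each non-zero $X$ there is $P$ in $\mathcal{P}$ with $\mathcal{S}(P,X)\ne 0$. $\mathcal{I}$ is closed under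 countable coproducts if the coproduct of any countable family of maps in $\mathcal{I}$ is in $\mathcal{I}$. Length: $\mathcal{P}_0$ is the class of zero objects, $\mathcal{P}_1=\mathcal{P}$, and inductively $\mathcal{P}_n$ is the class of retracts of objects $V$ in cofibre sequences $U\to V\to P$ with $U$ in $\mathcal{P}_{n-1}$, $P$ in $\mathcal{P}$. $X$ has length at most $n$ if $X$ is in $\mathcal{P}_n$. Write $\mathcal{S}(X,Y)_n=\mathcal{S}(\Sigma^nX,Y)$. An Adams resolution of $X$ is a sequence $X=X_0\to X_1\to X_2\to\cdots$ of maps in $\mathcal{I}$ together with exact triangles $P_n\to X_n\to X_{n+1}\to\Sigma P_n$ with each $P_n$ in $\mathcal{P}$. Applying $\mathcal{S}(-,Y)_*$ gives an exact couple with terms $\mathcal{S}(X_n,Y)_*$ and $\mathcal{S}(P_n,Y)_*$, whose spectral sequence (with $E_1^s=\mathcal{S}(P_s,Y)_*$ in homological degree $s\ge 0$, and $d_r$ raising $s$ by $r$) is the Adams spectral sequence abutting to $\mathcal{S}(X,Y)$; from $E_2$ on it is independent of the choice of resolution. Rows are indexed by the homological degree $s$, so the first $n$ rows are $s=0,\dots,n-1$. The corresponding filtration of $\mathcal{S}(X,Y)_*$ has $s$th stage the image of $\mathcal{S}(X_s,Y)_*$, which is $\mathcal{I}^s(X,Y)_*$ ($\mathcal{I}^s$ being the class of $s$-fold composites of maps in $\mathcal{I}$). Strong convergence is in Boardman's sense: the filtration of $\mathcal{S}(X,Y)_*$ is exhaustive, Hausdorff and complete, and $E_\infty$ is its associated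 graded.
   Formalization: For n = 0 the first claim is proved for a suitable Adams resolution rather than for every one, since E_1 depends on the resolution (the zero object has resolutions with E_1 nonzero); for n ≥ 1 it is proved for every Adams resolution. *)

theory Defs
  imports "HOL-Algebra.Coset"
begin

section \<open>Triangulated categories\<close>

record ('o, 'm) category =
  Obj :: "'o set"
  Arr :: "'m set"
  Dom :: "'m \<Rightarrow> 'o"
  Cod :: "'m \<Rightarrow> 'o"
  id_arr :: "'o \<Rightarrow> 'm"
  comp_arr :: "'m \<Rightarrow> 'm \<Rightarrow> 'm"  (infixl \<open>\<cdot>\<index>\<close> 70)

definition Hom :: "('o, 'm, 'z) category_scheme \<Rightarrow> 'o \<Rightarrow> 'o \<Rightarrow> 'm set" where
  "Hom C X Y = {f \<in> Arr C. Dom C f = X \<and> Cod C f = Y}"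

locale category =
  fixes C :: "('o, 'm, 'z) category_scheme" (structure)
  assumes Dom_Obj: "f \<in> Arr C \<Longrightarrow> Dom C f \<in> Obj C"
    and Cod_Obj: "f \<in> Arr C \<Longrightarrow> Cod C f \<in> Obj C"
    and id_Hom: "X \<in> Obj C \<Longrightarrow> id_arr C X \<in> Hom C X X"
    and comp_Hom: "\<lbrakk>f \<in> Hom C X Y; g \<in> Hom C Y Z\<rbrakk> \<Longrightarrow> g \<cdot> f \<in> Hom C X Z"
    and comp_assoc: "\<lbrakk>f \<in> Hom C W X; g \<in> Hom C X Y; h \<in> Hom C Y Z\<rbrakk> \<Longrightarrow> h \<cdot> (g \<cdot> f) = (h \<cdot> g) \<cdot> f"
    and id_left: "f \<in> Hom C X Y \<Longrightarrow> id_arr C Y \<cdot> f = f"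
    and id_right: "f \<in> Hom C X Y \<Longrightarrow> f \<cdot> id_arr C X = f"

definition iso_arr :: "('o, 'm, 'z) category_scheme \<Rightarrow> 'm \<Rightarrow> bool" where
  "iso_arr C f \<longleftrightarrow> f \<in> Arr C \<and>
     (\<exists>g \<in> Hom C (Cod C f) (Dom C f).
        g \<cdot>\<^bsub>C\<^esub> f = id_arr C (Dom C f) \<and> f \<cdot>\<^bsub>C\<^esub> g = id_arr C (Cod C f))"

definition retract_of :: "('o, 'm, 'z) category_scheme \<Rightarrow> 'o \<Rightarrow> 'o \<Rightarrow> bool" where
  "retract_of C X V \<longleftrightarrow> (\<exists>s \<in> Hom C X V. \<exists>r \<in> Hom C V X. r \<cdot>\<^bsub>C\<^esub> s = id_arr C X)"

definition zero_object :: "('o, 'm, 'z) category_scheme \<Rightarrow> 'o \<Rightarrow> bool" where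
  "zero_object C Z \<longleftrightarrow> Z \<in> Obj C \<and>
     (\<forall>X \<in> Obj C. (\<exists>!f. f \<in> Hom C Z X) \<and> (\<exists>!f. f \<in> Hom C X Z))"

definition is_coproduct ::
  "('o, 'm, 'z) category_scheme \<Rightarrow> 'i set \<Rightarrow> ('i \<Rightarrow> 'o) \<Rightarrow> 'o \<Rightarrow> ('i \<Rightarrow> 'm) \<Rightarrow> bool" where
  "is_coproduct C J A Q \<iota> \<longleftrightarrow> Q \<in> Obj C \<and> (\<forall>i \<in> J. \<iota> i \<in> Hom C (A i) Q) \<and>
     (\<forall>T \<in> Obj C. \<forall>f. (\<forall>i \<in> J. f i \<in> Hom C (A i) T) \<longrightarrow>
        (\<exists>!h. h \<in> Hom C Q T \<and> (\<forall>i \<in> J. h \<cdot>\<^bsub>C\<^esub> \<iota> i = f i)))"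

text \<open>
  Index sets are the subsets of an arbitrary type. Quantifying over all index types inside a
  formula is impossible in HOL, and demanding coproducts indexed by sets as large as the set of all
  arrows would force the category to be trivial, so the index type is a parameter that stands for
  the size of the sets of the ambient universe.
\<close>

definition has_coproducts :: "'i itself \<Rightarrow> ('o, 'm, 'z) category_scheme \<Rightarrow> bool" where
  "has_coproducts _ C \<longleftrightarrow>
     (\<forall>(J :: 'i set) A. (\<forall>i \<in> J. A i \<in> Obj C) \<longrightarrow> (\<exists>Q \<iota>. is_coproduct C J A Q \<iota>))"

record ('o, 'm) preadditive = "('o, 'm) category" +
  add_arr :: "'m \<Rightarrow> 'm \<Rightarrow> 'm"
  zero_arr :: "'o \<Rightarrow> 'o \<Rightarrow> 'm"

text \<open>The additive groups of morphisms are written multiplicatively, as is usual in HOL-Algebra.\<close>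

definition hom_group :: "('o, 'm, 'z) preadditive_scheme \<Rightarrow> 'o \<Rightarrow> 'o \<Rightarrow> 'm monoid" where
  "hom_group C X Y = \<lparr>carrier = Hom C X Y, mult = add_arr C, one = zero_arr C X Y\<rparr>"

definition neg_arr :: "('o, 'm, 'z) preadditive_scheme \<Rightarrow> 'm \<Rightarrow> 'm" where
  "neg_arr C f = inv\<^bsub>hom_group C (Dom C f) (Cod C f)\<^esub> f"

locale additive_category = category C
  for C :: "('o, 'm, 'z) preadditive_scheme" (structure) +
  assumes hom_comm_group: "\<lbrakk>X \<in> Obj C; Y \<in> Obj C\<rbrakk> \<Longrightarrow> comm_group (hom_group C X Y)"
    and comp_add_right: "\<lbrakk>f \<in> Hom C X Y; f' \<in> Hom C X Y; g \<in> Hom C Y Z\<rbrakk>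
          \<Longrightarrow> g \<cdot> add_arr C f f' = add_arr C (g \<cdot> f) (g \<cdot> f')"
    and comp_add_left: "\<lbrakk>f \<in> Hom C X Y; g \<in> Hom C Y Z; g' \<in> Hom C Y Z\<rbrakk>
          \<Longrightarrow> add_arr C g g' \<cdot> f = add_arr C (g \<cdot> f) (g' \<cdot> f)"
    and ex_zero_object: "\<exists>Z. zero_object C Z"
    and ex_biproduct: "\<lbrakk>X \<in> Obj C; Y \<in> Obj C\<rbrakk> \<Longrightarrow>
          \<exists>B \<in> Obj C. \<exists>i1 \<in> Hom C X B. \<exists>i2 \<in> Hom C Y B. \<exists>p1 \<in> Hom C B X. \<exists>p2 \<in> Hom C B Y.
            p1 \<cdot> i1 = id_arr C X \<and> p2 \<cdot> i2 = id_arr C Y \<and>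
            p1 \<cdot> i2 = zero_arr C Y X \<and> p2 \<cdot> i1 = zero_arr C X Y \<and>
            add_arr C (i1 \<cdot> p1) (i2 \<cdot> p2) = id_arr C B"

text \<open>
  An exact triangle \<open>X \<rightarrow> Y \<rightarrow> Z \<rightarrow> \<Sigma>X\<close> is represented by its triple of arrows. As in Verdier's
  definition, the suspension is an automorphism of the category.
\<close>

record ('o, 'm) triangulated = "('o, 'm) preadditive" +
  susp_obj :: "'o \<Rightarrow> 'o"
  susp_arr :: "'m \<Rightarrow> 'm"
  Tri :: "('m \<times> 'm \<times> 'm) set"

definition candidate_triangle ::
  "('o, 'm, 'z) triangulated_scheme \<Rightarrow> 'm \<Rightarrow> 'm \<Rightarrow> 'm \<Rightarrow> bool" where
  "candidate_triangle C u v w \<longleftrightarrow> u \<in> Arr C \<and> v \<in> Arr C \<and> w \<in> Arr C \<and>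
     Cod C u = Dom C v \<and> Cod C v = Dom C w \<and> Cod C w = susp_obj C (Dom C u)"

locale triangulated_category = additive_category C
  for C :: "('o, 'm, 'z) triangulated_scheme" (structure) +
  assumes susp_obj_bij: "bij_betw (susp_obj C) (Obj C) (Obj C)"
    and susp_arr_bij: "bij_betw (susp_arr C) (Arr C) (Arr C)"
    and susp_Hom: "f \<in> Hom C X Y \<Longrightarrow> susp_arr C f \<in> Hom C (susp_obj C X) (susp_obj C Y)"
    and susp_id: "X \<in> Obj C \<Longrightarrow> susp_arr C (id_arr C X) = id_arr C (susp_obj C X)"
    and susp_comp: "\<lbrakk>f \<in> Hom C X Y; g \<in> Hom C Y Z\<rbrakk>
          \<Longrightarrow> susp_arr C (g \<cdot> f) = susp_arr C g \<cdot> susp_arr C f"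
    and susp_add: "\<lbrakk>f \<in> Hom C X Y; g \<in> Hom C X Y\<rbrakk>
          \<Longrightarrow> susp_arr C (add_arr C f g) = add_arr C (susp_arr C f) (susp_arr C g)"
    and Tri_candidate: "(u, v, w) \<in> Tri C \<Longrightarrow> candidate_triangle C u v w"
    and TR1_iso: "\<lbrakk>(u, v, w) \<in> Tri C; candidate_triangle C u' v' w';
            iso_arr C a; Dom C a = Dom C u; Cod C a = Dom C u';
            iso_arr C b; Dom C b = Dom C v; Cod C b = Dom C v';
            iso_arr C c; Dom C c = Dom C w; Cod C c = Dom C w';
            u' \<cdot> a = b \<cdot> u; v' \<cdot> b = c \<cdot> v; w' \<cdot> c = susp_arr C a \<cdot> w\<rbrakk>
          \<Longrightarrow> (u', v', w') \<in> Tri C"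
    and TR1_id: "\<lbrakk>X \<in> Obj C; zero_object C Z\<rbrakk>
          \<Longrightarrow> (id_arr C X, zero_arr C X Z, zero_arr C Z (susp_obj C X)) \<in> Tri C"
    and TR1_cone: "u \<in> Arr C \<Longrightarrow> \<exists>v w. (u, v, w) \<in> Tri C"
    and TR2: "candidate_triangle C u v w
          \<Longrightarrow> (u, v, w) \<in> Tri C \<longleftrightarrow> (v, w, neg_arr C (susp_arr C u)) \<in> Tri C"
    and TR3: "\<lbrakk>(u, v, w) \<in> Tri C; (u', v', w') \<in> Tri C;
            a \<in> Hom C (Dom C u) (Dom C u'); b \<in> Hom C (Dom C v) (Dom C v'); u' \<cdot> a = b \<cdot> u\<rbrakk>
          \<Longrightarrow> \<exists>c \<in> Hom C (Dom C w) (Dom C w'). v' \<cdot> b = c \<cdot> v \<and> w' \<cdot> c = susp_arr C a \<cdot> w"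
    and TR4: "\<lbrakk>Cod C u = Dom C v; (u, j, k) \<in> Tri C; (v, l, m) \<in> Tri C; (v \<cdot> u, p, q) \<in> Tri C\<rbrakk>
          \<Longrightarrow> \<exists>f g. (f, g, susp_arr C j \<cdot> m) \<in> Tri C \<and>
                f \<in> Hom C (Cod C j) (Cod C p) \<and> g \<in> Hom C (Cod C p) (Cod C l) \<and>
                f \<cdot> j = p \<cdot> v \<and> q \<cdot> f = k \<and> g \<cdot> p = l \<and> m \<cdot> g = susp_arr C u \<cdot> q"

definition desusp_obj :: "('o, 'm, 'z) triangulated_scheme \<Rightarrow> 'o \<Rightarrow> 'o" where
  "desusp_obj C = inv_into (Obj C) (susp_obj C)"

definition desusp_arr :: "('o, 'm, 'z) triangulated_scheme \<Rightarrow> 'm \<Rightarrow> 'm" where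
  "desusp_arr C = inv_into (Arr C) (susp_arr C)"

definition shift_obj :: "('o, 'm, 'z) triangulated_scheme \<Rightarrow> int \<Rightarrow> 'o \<Rightarrow> 'o" where
  "shift_obj C t = (if 0 \<le> t then susp_obj C ^^ nat t else desusp_obj C ^^ nat (- t))"

definition shift_arr :: "('o, 'm, 'z) triangulated_scheme \<Rightarrow> int \<Rightarrow> 'm \<Rightarrow> 'm" where
  "shift_arr C t = (if 0 \<le> t then susp_arr C ^^ nat t else desusp_arr C ^^ nat (- t))"


section \<open>Projective classes\<close>

definition null_maps :: "('o, 'm, 'z) triangulated_scheme \<Rightarrow> 'o set \<Rightarrow> 'm set" where
  "null_maps C \<P> = {f \<in> Arr C. \<forall>P \<in> \<P>. \<forall>h \<in> Hom C P (Dom C f). f \<cdot>\<^bsub>C\<^esub> h = zero_arr C P (Cod C f)}"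

definition proj_objects :: "('o, 'm, 'z) triangulated_scheme \<Rightarrow> 'm set \<Rightarrow> 'o set" where
  "proj_objects C \<I> =
     {P \<in> Obj C. \<forall>f \<in> \<I>. \<forall>h \<in> Hom C P (Dom C f). f \<cdot>\<^bsub>C\<^esub> h = zero_arr C P (Cod C f)}"

definition projective_class ::
  "('o, 'm, 'z) triangulated_scheme \<Rightarrow> 'o set \<Rightarrow> 'm set \<Rightarrow> bool" where
  "projective_class C \<P> \<I> \<longleftrightarrow> null_maps C \<P> = \<I> \<and> proj_objects C \<I> = \<P> \<and>
     (\<forall>X \<in> Obj C. \<exists>u v w. (u, v, w) \<in> Tri C \<and> Dom C u \<in> \<P> \<and> Cod C u = X \<and> v \<in> \<I>)"

definition stable_class ::
  "('o, 'm, 'z) triangulated_scheme \<Rightarrow> 'o set \<Rightarrow> 'm set \<Rightarrow> bool" where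
  "stable_class C \<P> \<I> \<longleftrightarrow>
     (\<forall>P \<in> \<P>. susp_obj C P \<in> \<P> \<and> desusp_obj C P \<in> \<P>) \<and>
     (\<forall>f \<in> \<I>. susp_arr C f \<in> \<I> \<and> desusp_arr C f \<in> \<I>)"

definition generates :: "('o, 'm, 'z) triangulated_scheme \<Rightarrow> 'o set \<Rightarrow> bool" where
  "generates C \<P> \<longleftrightarrow>
     (\<forall>X \<in> Obj C. \<not> zero_object C X \<longrightarrow> (\<exists>P \<in> \<P>. Hom C P X \<noteq> {zero_arr C P X}))"

definition closed_under_countable_coproducts ::
  "('o, 'm, 'z) category_scheme \<Rightarrow> 'm set \<Rightarrow> bool" where
  "closed_under_countable_coproducts C \<I> \<longleftrightarrow>
     (\<forall>(J :: nat set) f Q \<iota> R \<kappa> h.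
        (\<forall>i \<in> J. f i \<in> \<I>) \<and>
        is_coproduct C J (\<lambda>i. Dom C (f i)) Q \<iota> \<and> is_coproduct C J (\<lambda>i. Cod C (f i)) R \<kappa> \<and>
        h \<in> Hom C Q R \<and> (\<forall>i \<in> J. h \<cdot>\<^bsub>C\<^esub> \<iota> i = \<kappa> i \<cdot>\<^bsub>C\<^esub> f i)
        \<longrightarrow> h \<in> \<I>)"

fun length_class :: "('o, 'm, 'z) triangulated_scheme \<Rightarrow> 'o set \<Rightarrow> nat \<Rightarrow> 'o set" where
  "length_class C \<P> 0 = {Z. zero_object C Z}"
| "length_class C \<P> (Suc 0) = \<P>"
| "length_class C \<P> (Suc (Suc n)) =
     {X \<in> Obj C. \<exists>u v w. (u, v, w) \<in> Tri C \<and> Dom C u \<in> length_class C \<P> (Suc n) \<and>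
        Cod C v \<in> \<P> \<and> retract_of C X (Cod C u)}"

definition length_at_most ::
  "('o, 'm, 'z) triangulated_scheme \<Rightarrow> 'o set \<Rightarrow> 'o \<Rightarrow> nat \<Rightarrow> bool" where
  "length_at_most C \<P> X n \<longleftrightarrow> X \<in> length_class C \<P> n"


section \<open>The spectral sequence of an unrolled exact couple\<close>

text \<open>
  Bigraded abelian groups \<open>D s t\<close>, \<open>E s t\<close> (filtration degree \<open>s \<ge> 0\<close>, internal degree \<open>t\<close>) with
  maps \<open>i : D (s + 1) t \<rightarrow> D s t\<close>, \<open>j : D s t \<rightarrow> E s t\<close> and \<open>k : E s t \<rightarrow> D (s + 1) (t - 1)\<close>.
  The notation below is Boardman's: for \<open>r \<ge> 1\<close>,
  \<open>Z\<^sub>r = k\<^sup>-\<^sup>1 (im i\<^sup>r\<^sup>-\<^sup>1)\<close>, \<open>B\<^sub>r = j (ker i\<^sup>r\<^sup>-\<^sup>1)\<close>, \<open>E\<^sub>r = Z\<^sub>r / B\<^sub>r\<close> and \<open>d\<^sub>r\<close> is induced by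
  \<open>j \<circ> (i\<^sup>r\<^sup>-\<^sup>1)\<^sup>-\<^sup>1 \<circ> k\<close>.
\<close>

record ('a, 'b) unrolled_couple =
  Dgrp :: "nat \<Rightarrow> int \<Rightarrow> 'a monoid"
  Egrp :: "nat \<Rightarrow> int \<Rightarrow> 'b monoid"
  imap :: "nat \<Rightarrow> int \<Rightarrow> 'a \<Rightarrow> 'a"
  jmap :: "nat \<Rightarrow> int \<Rightarrow> 'a \<Rightarrow> 'b"
  kmap :: "nat \<Rightarrow> int \<Rightarrow> 'b \<Rightarrow> 'a"

text \<open>\<open>iter_i K r s t\<close> is the \<open>r\<close>-fold composite \<open>D (s + r) t \<rightarrow> D s t\<close>.\<close>

primrec iter_i :: "('a, 'b) unrolled_couple \<Rightarrow> nat \<Rightarrow> nat \<Rightarrow> int \<Rightarrow> 'a \<Rightarrow> 'a" where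
  "iter_i K 0 s t y = y"
| "iter_i K (Suc r) s t y = iter_i K r s t (imap K (s + r) t y)"

definition cycles :: "('a, 'b) unrolled_couple \<Rightarrow> nat \<Rightarrow> nat \<Rightarrow> int \<Rightarrow> 'b set" where
  "cycles K r s t = {x \<in> carrier (Egrp K s t).
     kmap K s t x \<in> iter_i K (r - 1) (s + 1) (t - 1) ` carrier (Dgrp K (s + r) (t - 1))}"

text \<open>
  In negative filtration degrees the couple is extended by \<open>E = 0\<close>, hence by \<open>D s = D 0\<close> and
  \<open>i = id\<close>; so \<open>i\<^sup>r\<^sup>-\<^sup>1\<close> on \<open>D s\<close> is the map to \<open>D 0\<close> once \<open>r - 1 \<ge> s\<close>.
\<close>

definition boundaries :: "('a, 'b) unrolled_couple \<Rightarrow> nat \<Rightarrow> nat \<Rightarrow> int \<Rightarrow> 'b set" where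
  "boundaries K r s t = jmap K s t ` {y \<in> carrier (Dgrp K s t).
     iter_i K (min (r - 1) s) (s - (r - 1)) t y = \<one>\<^bsub>Dgrp K (s - (r - 1)) t\<^esub>}"

definition page :: "('a, 'b) unrolled_couple \<Rightarrow> nat \<Rightarrow> nat \<Rightarrow> int \<Rightarrow> 'b set monoid" where
  "page K r s t = (Egrp K s t)\<lparr>carrier := cycles K r s t\<rparr> Mod boundaries K r s t"

definition differential :: "('a, 'b) unrolled_couple \<Rightarrow> nat \<Rightarrow> nat \<Rightarrow> int \<Rightarrow> 'b set \<Rightarrow> 'b set" where
  "differential K r s t c = (THE c'. \<exists>x \<in> c. \<exists>y \<in> carrier (Dgrp K (s + r) (t - 1)).
     iter_i K (r - 1) (s + 1) (t - 1) y = kmap K s t x \<and>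
     c' = boundaries K r (s + r) (t - 1) #>\<^bsub>Egrp K (s + r) (t - 1)\<^esub> jmap K (s + r) (t - 1) y)"

definition cycles_inf :: "('a, 'b) unrolled_couple \<Rightarrow> nat \<Rightarrow> int \<Rightarrow> 'b set" where
  "cycles_inf K s t = (\<Inter>r \<in> {1..}. cycles K r s t)"

definition boundaries_inf :: "('a, 'b) unrolled_couple \<Rightarrow> nat \<Rightarrow> int \<Rightarrow> 'b set" where
  "boundaries_inf K s t = (\<Union>r \<in> {1..}. boundaries K r s t)"

definition page_inf :: "('a, 'b) unrolled_couple \<Rightarrow> nat \<Rightarrow> int \<Rightarrow> 'b set monoid" where
  "page_inf K s t = (Egrp K s t)\<lparr>carrier := cycles_inf K s t\<rparr> Mod boundaries_inf K s t"

definition collapses_at :: "('a, 'b) unrolled_couple \<Rightarrow> nat \<Rightarrow> bool" where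
  "collapses_at K m \<longleftrightarrow> (\<forall>r \<ge> m. \<forall>s t. \<forall>c \<in> carrier (page K r s t).
     differential K r s t c = \<one>\<^bsub>page K r (s + r) (t - 1)\<^esub>)"

definition page_eq_page_inf :: "('a, 'b) unrolled_couple \<Rightarrow> nat \<Rightarrow> bool" where
  "page_eq_page_inf K m \<longleftrightarrow> (\<forall>s t. page K m s t = page_inf K s t)"

definition concentrated_in_first_rows :: "('a, 'b) unrolled_couple \<Rightarrow> nat \<Rightarrow> nat \<Rightarrow> bool" where
  "concentrated_in_first_rows K m n \<longleftrightarrow>
     (\<forall>s \<ge> n. \<forall>t. carrier (page K m s t) = {\<one>\<^bsub>page K m s t\<^esub>})"

definition filtration :: "('a, 'b) unrolled_couple \<Rightarrow> nat \<Rightarrow> int \<Rightarrow> 'a set" where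
  "filtration K s t = iter_i K s 0 t ` carrier (Dgrp K s t)"

text \<open>
  The target group is \<open>D 0 t\<close>. Completeness is the vanishing of the first derived limit of the
  filtration, computed as the cokernel of \<open>(b\<^sub>s) \<mapsto> (b\<^sub>s - b\<^sub>s\<^sub>+\<^sub>1)\<close>. The last clause says that
  \<open>[i\<^sup>s y] \<mapsto> [j y]\<close> is a well-defined isomorphism from the associated graded group to \<open>E\<^sub>\<infinity>\<close>.
\<close>

definition converges_strongly :: "('a, 'b) unrolled_couple \<Rightarrow> bool" where
  "converges_strongly K \<longleftrightarrow> (\<forall>t.
     (\<Union>s. filtration K s t) = carrier (Dgrp K 0 t) \<and>
     (\<Inter>s. filtration K s t) = {\<one>\<^bsub>Dgrp K 0 t\<^esub>} \<and>
     (\<forall>a. (\<forall>s. a s \<in> filtration K s t) \<longrightarrow>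
        (\<exists>b. \<forall>s. b s \<in> filtration K s t \<and>
           a s = b s \<otimes>\<^bsub>Dgrp K 0 t\<^esub> inv\<^bsub>Dgrp K 0 t\<^esub> b (Suc s))) \<and>
     (\<forall>s. \<exists>\<phi> \<in> iso ((Dgrp K 0 t)\<lparr>carrier := filtration K s t\<rparr> Mod filtration K (Suc s) t)
                   (page_inf K s t).
        \<forall>y \<in> carrier (Dgrp K s t).
          \<phi> (filtration K (Suc s) t #>\<^bsub>Dgrp K 0 t\<^esub> iter_i K s 0 t y) =
            boundaries_inf K s t #>\<^bsub>Egrp K s t\<^esub> jmap K s t y))"


section \<open>The Adams spectral sequence\<close>

text \<open>Exact triangles \<open>P\<^sub>s \<rightarrow> X\<^sub>s \<rightarrow> X\<^sub>s\<^sub>+\<^sub>1 \<rightarrow> \<Sigma>P\<^sub>s\<close>.\<close>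

record ('o, 'm) resolution =
  res_obj :: "nat \<Rightarrow> 'o"
  res_proj :: "nat \<Rightarrow> 'o"
  res_cover :: "nat \<Rightarrow> 'm"
  res_map :: "nat \<Rightarrow> 'm"
  res_bd :: "nat \<Rightarrow> 'm"

definition adams_resolution ::
  "('o, 'm, 'z) triangulated_scheme \<Rightarrow> 'o set \<Rightarrow> 'm set \<Rightarrow> 'o \<Rightarrow> ('o, 'm) resolution \<Rightarrow> bool" where
  "adams_resolution C \<P> \<I> X R \<longleftrightarrow> res_obj R 0 = X \<and>
     (\<forall>s. res_proj R s \<in> \<P> \<and>
          res_cover R s \<in> Hom C (res_proj R s) (res_obj R s) \<and>
          res_map R s \<in> Hom C (res_obj R s) (res_obj R (Suc s)) \<and>
          res_bd R s \<in> Hom C (res_obj R (Suc s)) (susp_obj C (res_proj R s)) \<and>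
          res_map R s \<in> \<I> \<and>
          (res_cover R s, res_map R s, res_bd R s) \<in> Tri C)"

text \<open>
  \<open>D s t = S(\<Sigma>\<^sup>t X\<^sub>s, Y)\<close> and \<open>E s t = S(\<Sigma>\<^sup>t P\<^sub>s, Y)\<close>. The map \<open>k\<close> is precomposition with
  \<open>\<Sigma>\<^sup>t\<^sup>-\<^sup>1 X\<^sub>s\<^sub>+\<^sub>1 \<rightarrow> \<Sigma>\<^sup>t\<^sup>-\<^sup>1 \<Sigma> P\<^sub>s = \<Sigma>\<^sup>t P\<^sub>s\<close>.
\<close>

definition adams_couple ::
  "('o, 'm, 'z) triangulated_scheme \<Rightarrow> ('o, 'm) resolution \<Rightarrow> 'o \<Rightarrow> ('m, 'm) unrolled_couple" where
  "adams_couple C R Y =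
     \<lparr>Dgrp = (\<lambda>s t. hom_group C (shift_obj C t (res_obj R s)) Y),
      Egrp = (\<lambda>s t. hom_group C (shift_obj C t (res_proj R s)) Y),
      imap = (\<lambda>s t g. g \<cdot>\<^bsub>C\<^esub> shift_arr C t (res_map R s)),
      jmap = (\<lambda>s t g. g \<cdot>\<^bsub>C\<^esub> shift_arr C t (res_cover R s)),
      kmap = (\<lambda>s t g. g \<cdot>\<^bsub>C\<^esub> shift_arr C (t - 1) (res_bd R s))\<rparr>"

definition collapses_in_rows ::
  "('o, 'm, 'z) triangulated_scheme \<Rightarrow> ('o, 'm) resolution \<Rightarrow> 'o \<Rightarrow> nat \<Rightarrow> bool" where
  "collapses_in_rows C R Y n \<longleftrightarrow>
     collapses_at (adams_couple C R Y) (n + 1) \<and>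
     page_eq_page_inf (adams_couple C R Y) (n + 1) \<and>
     concentrated_in_first_rows (adams_couple C R Y) (n + 1) n"

end

theory Submission
  imports Defs
begin

text \<open>
  Everything is controlled by the composites \<open>X\<^sub>s \<rightarrow> X\<^sub>s\<^sub>+\<^sub>n\<close> in an Adams resolution.

  If \<open>X\<close> has length at most \<open>n\<close>, then any composite of \<open>n\<close> maps in \<open>\<I>\<close> out of \<open>X\<close> vanishes
  (\<open>ghost_lemma\<close>), in particular \<open>X \<rightarrow> X\<^sub>n\<close>. For \<open>n > 0\<close> the triangles of the resolution then make all
  composites \<open>X\<^sub>s \<rightarrow> X\<^sub>s\<^sub>+\<^sub>n\<close> vanish (\<open>res_comp_zero_everywhere\<close>); for \<open>n = 0\<close> this is true of the constant
  resolution of a zero object. So in the exact couple all \<open>n\<close>-fold iterates of \<open>i\<close> are zero, and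
  diagram chasing finishes the forward direction. Beyond page \<open>n\<close> the cycles are \<open>ker k = im j\<close>, and
  in the rows from \<open>n\<close> on every such element is a boundary, so that the pages are constant and
  concentrated in the first \<open>n\<close> rows. The filtration of the target has at most \<open>n\<close> nontrivial
  quotients, which makes it complete and Hausdorff (\<open>converges_strongly_if_trivial\<close>).

  Conversely, suppose that the spectral sequence for \<open>Y = X\<^sub>n\<close> collapses in this way. If \<open>\<P>\<close> generates
  and \<open>\<I>\<close> is closed under countable coproducts, then the telescope of the \<open>X\<^sub>s\<close> is zero, so the inverse
  limit of the groups \<open>Hom(X\<^sub>s, Y)\<close> vanishes (\<open>compatible_maps_vanish\<close>). Since the cycles are constant
  from page \<open>n + 1\<close> on, elements in all stages of the filtration lift to this limit, and the
  filtration is Hausdorff. It is also constant from stage \<open>n\<close> on, as there are no surviving classes in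
  the rows from \<open>n\<close> on; so stage \<open>n\<close> is zero (\<open>filtration_vanishes\<close>). It contains \<open>X \<rightarrow> X\<^sub>n\<close>, the image of the
  identity of \<open>X\<^sub>n\<close>. Finally, if \<open>X \<rightarrow> X\<^sub>n\<close> is zero, then \<open>\<Sigma>X\<close> is a retract of the cone of this map, which
  is built from \<open>\<Sigma>P\<^sub>0, \<dots>, \<Sigma>P\<^sub>n\<^sub>-\<^sub>1\<close> by the octahedral axiom and so has length at most \<open>n\<close>
  (\<open>length_if_res_comp_zero\<close>); desuspending gives the claim for \<open>X\<close>.
\<close>

section \<open>Quotients of subgroups of abelian groups\<close>

lemma carrier_Mod_subgroup:
  "carrier (G\<lparr>carrier := A\<rparr> Mod B) = (\<lambda>x. B #>\<^bsub>G\<^esub> x) ` A"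
  by (auto simp: FactGroup_def RCOSETS_def r_coset_def)

lemma (in group) carrier_Mod_eq_self_iff:
  assumes "subgroup A G" "subgroup B G" "B \<subseteq> A"
  shows "carrier (G\<lparr>carrier := A\<rparr> Mod B) = {B} \<longleftrightarrow> A = B"
proof
  show "A = B" if *: "carrier (G\<lparr>carrier := A\<rparr> Mod B) = {B}"
  proof (rule antisym[OF _ assms(3)], rule subsetI)
    fix a assume a: "a \<in> A"
    then have "B #> a = B"
      using * unfolding carrier_Mod_subgroup by auto
    then show "a \<in> B"
      using coset_join1 a assms(1,2) subgroup.mem_carrier[of A G a] by simp
  qed
  show "carrier (G\<lparr>carrier := A\<rparr> Mod B) = {B}" if "A = B"
  proof -
    have "B #> a = B" if "a \<in> B" for a
      using that coset_join2[OF subgroup.mem_carrier[OF assms(2) that] assms(2)] by simp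
    moreover have "\<one> \<in> B" using assms(2) by (rule subgroup.one_closed)
    ultimately show ?thesis
      unfolding carrier_Mod_subgroup \<open>A = B\<close> by auto
  qed
qed

text \<open>
  A page of a spectral sequence is a set of cosets of the boundaries in the cycles. Both groups can
  be read off from it: the boundaries are its unit and the cycles are the union of its elements.
\<close>

lemma (in group) Union_carrier_Mod:
  assumes "subgroup A G" "subgroup B G" "B \<subseteq> A"
  shows "\<Union> (carrier (G\<lparr>carrier := A\<rparr> Mod B)) = A"
proof -
  have "a \<in> B #> a" if "a \<in> A" for a
    using rcos_self[OF subgroup.mem_carrier[OF assms(1) that] assms(2)] .
  moreover have "B #> a \<subseteq> A" if "a \<in> A" for a
    using that assms(3) subgroup.m_closed[OF assms(1)] by (auto simp: r_coset_def)
  ultimately show ?thesis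
    unfolding carrier_Mod_subgroup by blast
qed

lemma comm_group_rcos_eq_iff:
  assumes "comm_group G" "subgroup M G" "x \<in> carrier G" "y \<in> carrier G"
  shows "M #>\<^bsub>G\<^esub> x = M #>\<^bsub>G\<^esub> y \<longleftrightarrow> x \<otimes>\<^bsub>G\<^esub> inv\<^bsub>G\<^esub> y \<in> M"
proof -
  interpret comm_group G by fact
  show ?thesis
    using assms
    by (metis coset_join1 coset_join2 coset_mult_inv1 coset_mult_inv2 inv_closed m_closed
        subgroup.subset)
qed

text \<open>
  Both quotients are \<open>G\<close> modulo the same subgroup \<open>a\<^sup>-\<^sup>1 M = b\<^sup>-\<^sup>1 N\<close>. This yields the isomorphism of
  an associated graded group with a term of a limit page, where \<open>a\<close> is an iterate of \<open>i\<close> and \<open>b\<close> is \<open>j\<close>.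
\<close>

lemma quotients_of_images_iso:
  assumes G: "comm_group G" and H: "comm_group H" and K: "comm_group K"
    and a: "a \<in> hom G H" and b: "b \<in> hom G K"
    and M: "subgroup M H" and N: "subgroup N K"
    and same_kernel: "\<And>x. x \<in> carrier G \<Longrightarrow> a x \<in> M \<longleftrightarrow> b x \<in> N"
  shows "\<exists>\<phi> \<in> iso (H\<lparr>carrier := a ` carrier G\<rparr> Mod M) (K\<lparr>carrier := b ` carrier G\<rparr> Mod N).
           \<forall>x \<in> carrier G. \<phi> (M #>\<^bsub>H\<^esub> a x) = N #>\<^bsub>K\<^esub> b x"
proof -
  interpret G: comm_group G by fact
  interpret H: comm_group H by fact
  interpret K: comm_group K by fact
  interpret a: group_hom G H a by (unfold_locales, rule a)
  interpret b: group_hom G K b by (unfold_locales, rule b)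
  have same_coset: "M #>\<^bsub>H\<^esub> a x = M #>\<^bsub>H\<^esub> a y \<longleftrightarrow> N #>\<^bsub>K\<^esub> b x = N #>\<^bsub>K\<^esub> b y"
    if "x \<in> carrier G" "y \<in> carrier G" for x y
  proof -
    have "M #>\<^bsub>H\<^esub> a x = M #>\<^bsub>H\<^esub> a y \<longleftrightarrow> a (x \<otimes>\<^bsub>G\<^esub> inv\<^bsub>G\<^esub> y) \<in> M"
      using that by (simp add: comm_group_rcos_eq_iff[OF H M])
    also have "\<dots> \<longleftrightarrow> b (x \<otimes>\<^bsub>G\<^esub> inv\<^bsub>G\<^esub> y) \<in> N"
      using that by (intro same_kernel) simp
    also have "\<dots> \<longleftrightarrow> N #>\<^bsub>K\<^esub> b x = N #>\<^bsub>K\<^esub> b y"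
      using that by (simp add: comm_group_rcos_eq_iff[OF K N])
    finally show ?thesis .
  qed
  define \<phi> where "\<phi> c = N #>\<^bsub>K\<^esub> b (SOME x. x \<in> carrier G \<and> c = M #>\<^bsub>H\<^esub> a x)" for c
  have \<phi>: "\<phi> (M #>\<^bsub>H\<^esub> a x) = N #>\<^bsub>K\<^esub> b x" if "x \<in> carrier G" for x
  proof -
    let ?x = "SOME x'. x' \<in> carrier G \<and> M #>\<^bsub>H\<^esub> a x = M #>\<^bsub>H\<^esub> a x'"
    have "?x \<in> carrier G \<and> M #>\<^bsub>H\<^esub> a x = M #>\<^bsub>H\<^esub> a ?x"
      by (rule someI[of _ x]) (simp add: that)
    then show ?thesis
      unfolding \<phi>_def using same_coset that by metis
  qed
  have carH: "carrier (H\<lparr>carrier := a ` carrier G\<rparr> Mod M) = (\<lambda>x. M #>\<^bsub>H\<^esub> a x) ` carrier G"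
    by (simp add: carrier_Mod_subgroup image_image)
  have carK: "carrier (K\<lparr>carrier := b ` carrier G\<rparr> Mod N) = (\<lambda>x. N #>\<^bsub>K\<^esub> b x) ` carrier G"
    by (simp add: carrier_Mod_subgroup image_image)
  have multH: "(M #>\<^bsub>H\<^esub> a x) <#>\<^bsub>H\<^esub> (M #>\<^bsub>H\<^esub> a y)
      = M #>\<^bsub>H\<^esub> a (x \<otimes>\<^bsub>G\<^esub> y)" if "x \<in> carrier G" "y \<in> carrier G" for x y
    using that normal.rcos_sum[OF H.subgroup_imp_normal[OF M]]
    by simp
  have multK: "(N #>\<^bsub>K\<^esub> b x) <#>\<^bsub>K\<^esub> (N #>\<^bsub>K\<^esub> b y)
      = N #>\<^bsub>K\<^esub> b (x \<otimes>\<^bsub>G\<^esub> y)" if "x \<in> carrier G" "y \<in> carrier G" for x y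
    using that normal.rcos_sum[OF K.subgroup_imp_normal[OF N]]
    by simp
  have "\<phi> \<in> hom (H\<lparr>carrier := a ` carrier G\<rparr> Mod M) (K\<lparr>carrier := b ` carrier G\<rparr> Mod N)"
    unfolding hom_def carH carK
    by (auto simp: \<phi> multH multK a.hom_mult[symmetric] b.hom_mult[symmetric]
        simp del: a.hom_mult b.hom_mult)
  moreover have "bij_betw \<phi> (carrier (H\<lparr>carrier := a ` carrier G\<rparr> Mod M))
      (carrier (K\<lparr>carrier := b ` carrier G\<rparr> Mod N))"
    unfolding carH carK bij_betw_def
  proof
    show "inj_on \<phi> ((\<lambda>x. M #>\<^bsub>H\<^esub> a x) ` carrier G)"
      proof (rule inj_onI, elim imageE)
      fix c d x y
      assume *: "\<phi> c = \<phi> d" "c = M #>\<^bsub>H\<^esub> a x" "d = M #>\<^bsub>H\<^esub> a y" "x \<in> carrier G" "y \<in> carrier G"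
      then have "N #>\<^bsub>K\<^esub> b x = N #>\<^bsub>K\<^esub> b y"
        by (simp add: \<phi>)
      then show "c = d"
        unfolding *(2,3) same_coset[OF *(4,5)] .
    qed
    show "\<phi> ` (\<lambda>x. M #>\<^bsub>H\<^esub> a x) ` carrier G = (\<lambda>x. N #>\<^bsub>K\<^esub> b x) ` carrier G"
      unfolding image_image by (rule image_cong) (auto simp: \<phi>)
  qed
  ultimately show ?thesis
    using \<phi> by (intro bexI[of _ \<phi>]) (auto simp: iso_def)
qed

section \<open>Unrolled exact couples\<close>

locale exact_couple =
  fixes K :: "('a, 'b) unrolled_couple"
  assumes D_comm_group: "comm_group (Dgrp K s t)"
    and E_comm_group: "comm_group (Egrp K s t)"
    and i_hom: "imap K s t \<in> hom (Dgrp K (Suc s) t) (Dgrp K s t)"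
    and j_hom: "jmap K s t \<in> hom (Dgrp K s t) (Egrp K s t)"
    and k_hom: "kmap K s t \<in> hom (Egrp K s t) (Dgrp K (Suc s) (t - 1))"
    and ker_i: "y \<in> carrier (Dgrp K (Suc s) (t - 1)) \<Longrightarrow>
      imap K s (t - 1) y = \<one>\<^bsub>Dgrp K s (t - 1)\<^esub> \<longleftrightarrow> y \<in> kmap K s t ` carrier (Egrp K s t)"
    and ker_j: "y \<in> carrier (Dgrp K s t) \<Longrightarrow>
      jmap K s t y = \<one>\<^bsub>Egrp K s t\<^esub> \<longleftrightarrow> y \<in> imap K s t ` carrier (Dgrp K (Suc s) t)"
    and ker_k: "x \<in> carrier (Egrp K s t) \<Longrightarrow>
      kmap K s t x = \<one>\<^bsub>Dgrp K (Suc s) (t - 1)\<^esub> \<longleftrightarrow> x \<in> jmap K s t ` carrier (Dgrp K s t)"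
begin

sublocale D: comm_group "Dgrp K s t" for s t
  by (rule D_comm_group)

sublocale E: comm_group "Egrp K s t" for s t
  by (rule E_comm_group)

sublocale i: group_hom "Dgrp K (Suc s) t" "Dgrp K s t" "imap K s t" for s t
  by unfold_locales (rule i_hom)

sublocale j: group_hom "Dgrp K s t" "Egrp K s t" "jmap K s t" for s t
  by unfold_locales (rule j_hom)

sublocale k: group_hom "Egrp K s t" "Dgrp K (Suc s) (t - 1)" "kmap K s t" for s t
  by unfold_locales (rule k_hom)

lemma iter_i_hom: "iter_i K r s t \<in> hom (Dgrp K (s + r) t) (Dgrp K s t)"
proof (induction r)
  case 0
  show ?case by (auto simp: hom_def)
next
  case (Suc r)
  have "iter_i K (Suc r) s t = iter_i K r s t \<circ> imap K (s + r) t"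
    by auto
  then show ?case
    using Group.hom_compose[OF i_hom Suc.IH] by (simp only: add_Suc_right)
qed

sublocale iter: group_hom "Dgrp K (s + r) t" "Dgrp K s t" "iter_i K r s t" for s r t
  by unfold_locales (rule iter_i_hom)

lemma iter_i_add: "iter_i K (a + b) s t y = iter_i K a s t (iter_i K b (s + a) t y)"
  by (induction b arbitrary: y) (simp_all add: add.assoc)

lemma iter_i_Suc_left: "iter_i K (Suc a) s t y = imap K s t (iter_i K a (Suc s) t y)"
  using iter_i_add[of 1 a s t y] by simp

text \<open>
  The decreasing filtration of \<open>D s t\<close> by the images of the iterates of \<open>i\<close>. At \<open>s = 0\<close> it is the
  filtration of the target; at other \<open>s\<close> it measures which elements are cycles.
\<close>

definition stage :: "nat \<Rightarrow> nat \<Rightarrow> int \<Rightarrow> 'a set" where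
  "stage r s t = iter_i K r s t ` carrier (Dgrp K (s + r) t)"

lemma stage_subgroup: "subgroup (stage r s t) (Dgrp K s t)"
  unfolding stage_def by (rule iter.img_is_subgroup)

lemma stage_antimono:
  assumes "a \<le> b"
  shows "stage b s t \<subseteq> stage a s t"
proof
  fix y assume "y \<in> stage b s t"
  then obtain z where z: "z \<in> carrier (Dgrp K (s + b) t)" "y = iter_i K b s t z"
    unfolding stage_def by auto
  have "y = iter_i K a s t (iter_i K (b - a) (s + a) t z)"
    using iter_i_add[of a "b - a" s t z] z assms by simp
  moreover have "iter_i K (b - a) (s + a) t z \<in> carrier (Dgrp K (s + a) t)"
    using iter.hom_closed[where s = "s + a" and r = "b - a"] z assms by simp
  ultimately show "y \<in> stage a s t"
    unfolding stage_def by blast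
qed

lemma filtration_eq_stage: "filtration K s t = stage s 0 t"
  by (simp add: filtration_def stage_def)

lemma cycles_eq_stage:
  assumes "1 \<le> r"
  shows "cycles K r s t =
    {x \<in> carrier (Egrp K s t). kmap K s t x \<in> stage (r - 1) (Suc s) (t - 1)}"
  using assms by (simp add: cycles_def stage_def)

lemma cycles_subgroup:
  assumes "1 \<le> r"
  shows "subgroup (cycles K r s t) (Egrp K s t)"
proof (rule E.subgroupI)
  interpret stage: subgroup "stage (r - 1) (Suc s) (t - 1)" "Dgrp K (Suc s) (t - 1)"
    by (rule stage_subgroup)
  show "cycles K r s t \<noteq> {}"
    using cycles_eq_stage[OF assms] E.one_closed k.hom_one stage.one_closed
    by (metis (mono_tags, lifting) empty_iff mem_Collect_eq)
qed (use assms in \<open>auto simp: cycles_eq_stage subgroup.m_closed[OF stage_subgroup]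
      subgroup.m_inv_closed[OF stage_subgroup]\<close>)

definition im_j :: "nat \<Rightarrow> int \<Rightarrow> 'b set" where
  "im_j s t = jmap K s t ` carrier (Dgrp K s t)"

lemma im_j_eq_ker_k:
  "im_j s t = {x \<in> carrier (Egrp K s t). kmap K s t x = \<one>\<^bsub>Dgrp K (Suc s) (t - 1)\<^esub>}"
  unfolding im_j_def using ker_k by auto

lemma im_j_subset_cycles: "1 \<le> r \<Longrightarrow> im_j s t \<subseteq> cycles K r s t"
  unfolding im_j_eq_ker_k cycles_eq_stage
  using subgroup.one_closed[OF stage_subgroup] by auto

lemma im_j_subgroup: "subgroup (im_j s t) (Egrp K s t)"
  unfolding im_j_def by (rule j.img_is_subgroup)

lemma boundaries_subgroup: "subgroup (boundaries K r s t) (Egrp K s t)"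
proof -
  define m where "m = min (r - 1) s"
  have s: "s = (s - (r - 1)) + m" by (simp add: m_def)
  have hom: "iter_i K m (s - (r - 1)) t \<in> hom (Dgrp K s t) (Dgrp K (s - (r - 1)) t)"
    using iter_i_hom[of m "s - (r - 1)" t] unfolding s[symmetric] .
  interpret h: group_hom "Dgrp K s t" "Dgrp K (s - (r - 1)) t" "iter_i K m (s - (r - 1)) t"
    by unfold_locales (rule hom)
  show ?thesis
    unfolding boundaries_def m_def[symmetric]
    using j.subgroup_img_is_subgroup[OF h.subgroup_kernel] by (simp add: kernel_def)
qed

lemma boundaries_subset_im_j: "boundaries K r s t \<subseteq> im_j s t"
  unfolding boundaries_def im_j_def by auto

lemma boundaries_past_row:
  assumes "s < r"
  shows "boundaries K r s t =
    jmap K s t ` {y \<in> carrier (Dgrp K s t). iter_i K s 0 t y = \<one>\<^bsub>Dgrp K 0 t\<^esub>}"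
  using assms by (simp add: boundaries_def)

text \<open>
  The boundaries increase with \<open>r\<close> and are stationary once the iterate of \<open>i\<close> reaches \<open>D 0\<close>, because
  the couple is constant in negative filtration degrees.
\<close>

lemma boundaries_inf_eq:
  "boundaries_inf K s t =
    jmap K s t ` {y \<in> carrier (Dgrp K s t). iter_i K s 0 t y = \<one>\<^bsub>Dgrp K 0 t\<^esub>}"
proof
  have "boundaries K r s t \<subseteq> boundaries K (Suc s) s t" for r
  proof (cases "s < r")
    case False
    have "iter_i K s 0 t y = \<one>\<^bsub>Dgrp K 0 t\<^esub>"
      if "iter_i K (r - 1) (s - (r - 1)) t y = \<one>\<^bsub>Dgrp K (s - (r - 1)) t\<^esub>" for y
      using that iter_i_add[of "s - (r - 1)" "r - 1" 0 t y] iter.hom_one[of "s - (r - 1)" 0 t] False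
      by simp
    then show ?thesis
      using False unfolding boundaries_past_row[OF lessI]
      by (auto simp: boundaries_def min_def)
  qed (simp add: boundaries_past_row)
  then show "boundaries_inf K s t \<subseteq>
      jmap K s t ` {y \<in> carrier (Dgrp K s t). iter_i K s 0 t y = \<one>\<^bsub>Dgrp K 0 t\<^esub>}"
    unfolding boundaries_inf_def boundaries_past_row[OF lessI, symmetric] by blast
  show "jmap K s t ` {y \<in> carrier (Dgrp K s t). iter_i K s 0 t y = \<one>\<^bsub>Dgrp K 0 t\<^esub>}
      \<subseteq> boundaries_inf K s t"
    unfolding boundaries_inf_def boundaries_past_row[OF lessI, symmetric] by force
qed

lemma boundaries_inf_eq_boundaries: "boundaries_inf K s t = boundaries K (Suc s) s t"
  by (simp add: boundaries_inf_eq boundaries_past_row)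

lemma cycles_inf_subgroup: "subgroup (cycles_inf K s t) (Egrp K s t)"
  unfolding cycles_inf_def by (rule E.subgroups_Inter) (auto simp: cycles_subgroup)

lemma im_j_subset_cycles_inf: "im_j s t \<subseteq> cycles_inf K s t"
  unfolding cycles_inf_def using im_j_subset_cycles by auto

end

context exact_couple
begin

text \<open>
  As \<open>ker j = im i\<close>, both sides say that \<open>y\<close> lies in \<open>im i\<close> plus the kernel of the map to \<open>D 0\<close>.
\<close>

lemma iter_i_mem_next_filtration_iff:
  assumes y: "y \<in> carrier (Dgrp K s t)"
  shows "iter_i K s 0 t y \<in> filtration K (Suc s) t \<longleftrightarrow> jmap K s t y \<in> boundaries_inf K s t"
proof
  have [simp]: "iter_i K s 0 t z \<in> carrier (Dgrp K 0 t)" if "z \<in> carrier (Dgrp K s t)" for z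
    using iter.hom_closed[where s = 0 and r = s] that by simp
  have mult: "iter_i K s 0 t (x \<otimes>\<^bsub>Dgrp K s t\<^esub> inv\<^bsub>Dgrp K s t\<^esub> z) =
      iter_i K s 0 t x \<otimes>\<^bsub>Dgrp K 0 t\<^esub> inv\<^bsub>Dgrp K 0 t\<^esub> iter_i K s 0 t z"
    if "x \<in> carrier (Dgrp K s t)" "z \<in> carrier (Dgrp K s t)" for x z
    using iter.hom_mult[where s = 0 and r = s, of x t] iter.hom_inv[where s = 0 and r = s, of z t] that
    by simp
  {
    assume "iter_i K s 0 t y \<in> filtration K (Suc s) t"
    then obtain z where z: "z \<in> carrier (Dgrp K (Suc s) t)"
        "iter_i K s 0 t y = iter_i K s 0 t (imap K s t z)"
      by (auto simp: filtration_def)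
    define y' where "y' = y \<otimes>\<^bsub>Dgrp K s t\<^esub> inv\<^bsub>Dgrp K s t\<^esub> imap K s t z"
    have "iter_i K s 0 t y' = \<one>\<^bsub>Dgrp K 0 t\<^esub>"
      using mult[OF y i.hom_closed[OF z(1)]] y z(1) by (simp add: y'_def z(2)[symmetric])
    moreover have "jmap K s t (imap K s t z) = \<one>\<^bsub>Egrp K s t\<^esub>"
      using z(1) by (simp add: ker_j)
    then have "jmap K s t y' = jmap K s t y"
      using y z(1) by (simp add: y'_def)
    moreover have "y' \<in> carrier (Dgrp K s t)"
      using y z(1) by (simp add: y'_def)
    ultimately show "jmap K s t y \<in> boundaries_inf K s t"
      unfolding boundaries_inf_eq by (metis (mono_tags, lifting) imageI mem_Collect_eq)
  next
    assume "jmap K s t y \<in> boundaries_inf K s t"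
    then obtain z where z: "z \<in> carrier (Dgrp K s t)" "iter_i K s 0 t z = \<one>\<^bsub>Dgrp K 0 t\<^esub>"
        "jmap K s t y = jmap K s t z"
      unfolding boundaries_inf_eq by auto
    define y' where "y' = y \<otimes>\<^bsub>Dgrp K s t\<^esub> inv\<^bsub>Dgrp K s t\<^esub> z"
    have y': "y' \<in> carrier (Dgrp K s t)" "jmap K s t y' = \<one>\<^bsub>Egrp K s t\<^esub>"
      using y z by (simp_all add: y'_def)
    then obtain x where x: "x \<in> carrier (Dgrp K (Suc s) t)" "y' = imap K s t x"
      using ker_j by auto
    have "iter_i K s 0 t y' = iter_i K s 0 t y"
      using mult[OF y z(1)] y z by (simp add: y'_def)
    then have "iter_i K s 0 t y = iter_i K (Suc s) 0 t x"
      using x(2) by simp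
    then show "iter_i K s 0 t y \<in> filtration K (Suc s) t"
      unfolding filtration_def using x(1) by blast
  }
qed

end

section \<open>Couples in which all \<open>n\<close>-fold iterates of \<open>i\<close> vanish\<close>

context exact_couple
begin

text \<open>
  The vanishing is required in every filtration degree and not just at the target \<open>D 0\<close>. It forces
  every cycle of a page beyond the \<open>n\<close>th into \<open>ker k = im j\<close>, and every element of \<open>im j\<close> in
  row \<open>s \<ge> n\<close> to be a boundary.
\<close>

context
  fixes n :: nat
  assumes iter_i_trivial: "\<And>s t y. y \<in> carrier (Dgrp K (s + n) t) \<Longrightarrow>
    iter_i K n s t y = \<one>\<^bsub>Dgrp K s t\<^esub>"
begin

lemma iter_i_trivial_le:
  assumes "n \<le> r" "y \<in> carrier (Dgrp K (s + r) t)"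
  shows "iter_i K r s t y = \<one>\<^bsub>Dgrp K s t\<^esub>"
proof -
  have "iter_i K r s t y = iter_i K n s t (iter_i K (r - n) (s + n) t y)"
    using iter_i_add[of n "r - n" s t y] assms(1) by simp
  also have "iter_i K (r - n) (s + n) t y \<in> carrier (Dgrp K (s + n) t)"
    using iter.hom_closed[where s = "s + n" and r = "r - n"] assms by simp
  then have "iter_i K n s t (iter_i K (r - n) (s + n) t y) = \<one>\<^bsub>Dgrp K s t\<^esub>"
    by (rule iter_i_trivial)
  finally show ?thesis .
qed

lemma stage_trivial: "n \<le> r \<Longrightarrow> stage r s t = {\<one>\<^bsub>Dgrp K s t\<^esub>}"
  unfolding stage_def using iter_i_trivial_le D.one_closed by (auto simp: image_iff)

lemma cycles_eq_im_j: "n < r \<Longrightarrow> cycles K r s t = im_j s t"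
  using stage_trivial[of "r - 1"] by (simp add: cycles_eq_stage im_j_eq_ker_k)

lemma cycles_inf_eq_im_j: "cycles_inf K s t = im_j s t"
proof (rule antisym[OF _ im_j_subset_cycles_inf])
  have "cycles_inf K s t \<subseteq> cycles K (Suc n) s t"
    unfolding cycles_inf_def by auto
  then show "cycles_inf K s t \<subseteq> im_j s t"
    by (simp add: cycles_eq_im_j)
qed

lemma boundaries_eq_im_j:
  assumes "n < r" "n \<le> s"
  shows "boundaries K r s t = im_j s t"
proof -
  define m where "m = min (r - 1) s"
  have s: "(s - (r - 1)) + m = s" and m: "n \<le> m"
    using assms by (auto simp: m_def)
  have "iter_i K m (s - (r - 1)) t y = \<one>\<^bsub>Dgrp K (s - (r - 1)) t\<^esub>"
    if "y \<in> carrier (Dgrp K s t)" for y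
    using iter_i_trivial_le[OF m, of y "s - (r - 1)" t] that unfolding s .
  then show ?thesis
    unfolding boundaries_def im_j_def m_def[symmetric] by auto
qed

lemma boundaries_eq_inf:
  assumes "n < r"
  shows "boundaries K r s t = boundaries_inf K s t"
proof (cases "n \<le> s")
  case True
  then show ?thesis
    unfolding boundaries_inf_eq_boundaries using assms by (simp add: boundaries_eq_im_j)
next
  case False
  then show ?thesis
    unfolding boundaries_inf_eq_boundaries using assms by (simp add: boundaries_past_row)
qed

lemma page_eq_page_inf_if_trivial: "page_eq_page_inf K (n + 1)"
  unfolding page_eq_page_inf_def page_def page_inf_def
  by (simp add: cycles_eq_im_j cycles_inf_eq_im_j boundaries_eq_inf)

lemma concentrated_if_trivial: "concentrated_in_first_rows K (n + 1) n"
proof -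
  have "carrier (Egrp K s t\<lparr>carrier := im_j s t\<rparr> Mod im_j s t) = {im_j s t}" for s t
    using E.carrier_Mod_eq_self_iff[OF im_j_subgroup im_j_subgroup order_refl] by simp
  then show ?thesis
    unfolding concentrated_in_first_rows_def page_def
    by (simp add: cycles_eq_im_j boundaries_eq_im_j)
qed

text \<open>
  The target row \<open>s + r\<close> lies beyond the first \<open>n\<close> rows, so that all of \<open>im j\<close> is a boundary there and
  every choice of \<open>x\<close> and \<open>y\<close> in the definition of the differential gives the trivial coset.
\<close>

lemma differential_trivial:
  assumes r: "n < r" and c: "c \<in> carrier (page K r s t)"
  shows "differential K r s t c = \<one>\<^bsub>page K r (s + r) (t - 1)\<^esub>"
proof -
  define B where "B = boundaries K r (s + r) (t - 1)"
  have B: "B = im_j (s + r) (t - 1)"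
    unfolding B_def using r by (intro boundaries_eq_im_j) auto
  from c obtain x0 where x0: "x0 \<in> im_j s t" "c = boundaries K r s t #>\<^bsub>Egrp K s t\<^esub> x0"
    unfolding page_def carrier_Mod_subgroup cycles_eq_im_j[OF r] by auto
  have c_sub: "c \<subseteq> im_j s t"
    unfolding x0(2) using boundaries_subset_im_j[of r s t] x0(1) subgroup.m_closed[OF im_j_subgroup]
    by (auto simp: r_coset_def)
  have "x0 \<in> c"
    unfolding x0(2)
    using E.rcos_self[OF subgroup.mem_carrier[OF im_j_subgroup x0(1)] boundaries_subgroup] .
  have coset: "B #>\<^bsub>Egrp K (s + r) (t - 1)\<^esub> jmap K (s + r) (t - 1) y = B"
    if "y \<in> carrier (Dgrp K (s + r) (t - 1))" for y
    using that E.coset_join2[OF _ im_j_subgroup] unfolding B by (auto simp: im_j_def)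
  have "differential K r s t c = B"
    unfolding differential_def B_def[symmetric]
  proof (rule the_equality)
    have "iter_i K (r - 1) (s + 1) (t - 1) \<one>\<^bsub>Dgrp K (s + r) (t - 1)\<^esub> = kmap K s t x0"
      using iter.hom_one[of "r - 1" "Suc s" "t - 1"] r x0(1) by (simp add: im_j_eq_ker_k)
    then show "\<exists>x\<in>c. \<exists>y\<in>carrier (Dgrp K (s + r) (t - 1)).
       iter_i K (r - 1) (s + 1) (t - 1) y = kmap K s t x \<and>
       B = B #>\<^bsub>Egrp K (s + r) (t - 1)\<^esub> jmap K (s + r) (t - 1) y"
      using \<open>x0 \<in> c\<close> coset[OF D.one_closed] D.one_closed by metis
  qed (auto simp: coset)
  then show ?thesis
    by (simp add: page_def B_def)
qed

lemma collapses_if_trivial: "collapses_at K (n + 1)"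
  unfolding collapses_at_def by (simp add: differential_trivial)

text \<open>
  The solution is \<open>b\<^sub>s = a\<^sub>s a\<^sub>s\<^sub>+\<^sub>1 a\<^sub>s\<^sub>+\<^sub>2 \<dots>\<close>, a finite product because \<open>a\<^sub>s = 1\<close> for \<open>s \<ge> n\<close>.
\<close>

lemma filtration_complete:
  assumes "\<And>s. a s \<in> filtration K s t"
  shows "\<exists>b. \<forall>s. b s \<in> filtration K s t \<and>
           a s = b s \<otimes>\<^bsub>Dgrp K 0 t\<^esub> inv\<^bsub>Dgrp K 0 t\<^esub> b (Suc s)"
proof -
  have sub: "subgroup (filtration K s t) (Dgrp K 0 t)" for s
    unfolding filtration_eq_stage by (rule stage_subgroup)
  have trivial: "filtration K s t = {\<one>\<^bsub>Dgrp K 0 t\<^esub>}" if "n \<le> s" for s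
    unfolding filtration_eq_stage using that by (rule stage_trivial)
  have anti: "filtration K (Suc s) t \<subseteq> filtration K s t" for s
    unfolding filtration_eq_stage by (rule stage_antimono) simp
  \<comment> \<open>\<open>b m\<close> is the product of the last \<open>m\<close> nontrivial factors, hence the value at \<open>s = n - m\<close>.\<close>
  define b where "b m = rec_nat \<one>\<^bsub>Dgrp K 0 t\<^esub> (\<lambda>m z. a (n - Suc m) \<otimes>\<^bsub>Dgrp K 0 t\<^esub> z) m" for m
  have b_0: "b 0 = \<one>\<^bsub>Dgrp K 0 t\<^esub>"
    and b_Suc: "b (Suc m) = a (n - Suc m) \<otimes>\<^bsub>Dgrp K 0 t\<^esub> b m" for m
    by (simp_all add: b_def)
  have b: "b m \<in> filtration K (n - m) t" if "m \<le> n" for m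
    using that
  proof (induction m)
    case 0
    then show ?case using subgroup.one_closed[OF sub] by (simp add: b_0)
  next
    case (Suc m)
    then have "b m \<in> filtration K (n - Suc m) t"
      using anti[of "n - Suc m"] by (auto simp: Suc_diff_Suc)
    then show ?case
      unfolding b_Suc using subgroup.m_closed[OF sub] assms by blast
  qed
  show ?thesis
  proof (intro exI[of _ "\<lambda>s. b (n - s)"] allI)
    fix s
    show "b (n - s) \<in> filtration K s t \<and>
        a s = b (n - s) \<otimes>\<^bsub>Dgrp K 0 t\<^esub> inv\<^bsub>Dgrp K 0 t\<^esub> b (n - Suc s)"
    proof (cases "n \<le> s")
      case True
      then show ?thesis
        using assms[of s] by (simp add: b_0 trivial)
    next
      case False
      then have "b (n - s) = a s \<otimes>\<^bsub>Dgrp K 0 t\<^esub> b (n - Suc s)"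
        using b_Suc[of "n - Suc s"] by (simp add: Suc_diff_Suc)
      moreover have "b (n - Suc s) \<in> carrier (Dgrp K 0 t)" "a s \<in> carrier (Dgrp K 0 t)"
        using subgroup.mem_carrier[OF sub] b[of "n - Suc s"] assms by auto
      ultimately show ?thesis
        using b[of "n - s"] False by (simp add: D.m_assoc)
    qed
  qed
qed

lemma converges_strongly_if_trivial: "converges_strongly K"
  unfolding converges_strongly_def
proof (intro allI conjI impI)
  fix t
  have sub: "filtration K s t \<subseteq> carrier (Dgrp K 0 t)" for s
    unfolding filtration_eq_stage using subgroup.subset[OF stage_subgroup] .
  moreover have "filtration K 0 t = carrier (Dgrp K 0 t)"
    by (simp add: filtration_def)
  ultimately show "(\<Union>s. filtration K s t) = carrier (Dgrp K 0 t)"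
    by blast
  have "filtration K n t = {\<one>\<^bsub>Dgrp K 0 t\<^esub>}"
    unfolding filtration_eq_stage by (simp add: stage_trivial)
  moreover have "\<one>\<^bsub>Dgrp K 0 t\<^esub> \<in> filtration K s t" for s
    unfolding filtration_eq_stage using subgroup.one_closed[OF stage_subgroup] .
  ultimately show "(\<Inter>s. filtration K s t) = {\<one>\<^bsub>Dgrp K 0 t\<^esub>}"
    by blast
  show "\<exists>b. \<forall>s. b s \<in> filtration K s t \<and>
           a s = b s \<otimes>\<^bsub>Dgrp K 0 t\<^esub> inv\<^bsub>Dgrp K 0 t\<^esub> b (Suc s)"
    if "\<forall>s. a s \<in> filtration K s t" for a
    using filtration_complete that by blast
  fix s
  have "subgroup (filtration K (Suc s) t) (Dgrp K 0 t)"
    unfolding filtration_eq_stage by (rule stage_subgroup)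
  moreover have "iter_i K s 0 t \<in> hom (Dgrp K s t) (Dgrp K 0 t)"
    using iter_i_hom[of s 0 t] by simp
  moreover have "subgroup (boundaries_inf K s t) (Egrp K s t)"
    unfolding boundaries_inf_eq_boundaries by (rule boundaries_subgroup)
  ultimately show "\<exists>\<phi> \<in> iso ((Dgrp K 0 t)\<lparr>carrier := filtration K s t\<rparr> Mod filtration K (Suc s) t)
                   (page_inf K s t).
        \<forall>y \<in> carrier (Dgrp K s t).
          \<phi> (filtration K (Suc s) t #>\<^bsub>Dgrp K 0 t\<^esub> iter_i K s 0 t y) =
            boundaries_inf K s t #>\<^bsub>Egrp K s t\<^esub> jmap K s t y"
    unfolding page_inf_def cycles_inf_eq_im_j im_j_def filtration_def[of K s t]
    by (intro quotients_of_images_iso D_comm_group E_comm_group j_hom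
        iter_i_mem_next_filtration_iff)
qed

end

end

section \<open>Vanishing of the filtration when the spectral sequence collapses\<close>

context exact_couple
begin

lemma page_eq_page_inf_imp:
  assumes "page_eq_page_inf K (n + 1)"
  shows "boundaries K (n + 1) s t = boundaries_inf K s t"
    and "cycles K (n + 1) s t = cycles_inf K s t"
proof -
  have eq: "page K (n + 1) s t = page_inf K s t"
    using assms by (simp add: page_eq_page_inf_def)
  then have "\<one>\<^bsub>page K (n + 1) s t\<^esub> = \<one>\<^bsub>page_inf K s t\<^esub>"
    by simp
  then show *: "boundaries K (n + 1) s t = boundaries_inf K s t"
    by (simp add: page_def page_inf_def)
  have B: "boundaries_inf K s t \<subseteq> im_j s t" "subgroup (boundaries_inf K s t) (Egrp K s t)"
    unfolding boundaries_inf_eq_boundaries by (rule boundaries_subset_im_j boundaries_subgroup)+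
  from eq have "\<Union> (carrier (page K (n + 1) s t)) = \<Union> (carrier (page_inf K s t))"
    by simp
  also have "\<Union> (carrier (page_inf K s t)) = cycles_inf K s t"
    unfolding page_inf_def
    using B im_j_subset_cycles_inf cycles_inf_subgroup by (intro E.Union_carrier_Mod) blast+
  also have "\<Union> (carrier (page K (n + 1) s t)) = cycles K (n + 1) s t"
    unfolding page_def *
    using B im_j_subset_cycles[of "n + 1" s t] cycles_subgroup[of "n + 1" s t]
    by (intro E.Union_carrier_Mod) auto
  finally show "cycles K (n + 1) s t = cycles_inf K s t" .
qed

text \<open>
  Let \<open>y\<close> be a preimage of \<open>a\<close> in the \<open>n\<close>th stage. It differs from a preimage in a deeper stage \<open>m\<close> by
  an element of \<open>ker i = im k\<close> that lies in the \<open>n\<close>th stage. Cycles that are constant from page \<open>n + 1\<close>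
  on mean that \<open>im k\<close> meets both stages in the same group, so \<open>y\<close> itself lies in stage \<open>m\<close>. This is how
  the vanishing of Boardman's obstruction group \<open>RE\<^sub>\<infinity>\<close> enters.
\<close>

lemma lift_stable_element:
  assumes cycles: "cycles K (n + 1) s (t + 1) = cycles_inf K s (t + 1)"
    and a: "\<And>r. a \<in> stage r s t"
  shows "\<exists>y \<in> carrier (Dgrp K (Suc s) t). imap K s t y = a \<and> (\<forall>r. y \<in> stage r (Suc s) t)"
proof -
  have lift: "\<exists>y \<in> stage r (Suc s) t. imap K s t y = a" for r
    using a[of "Suc r"] iter_i_Suc_left[of r s t] by (auto simp: stage_def simp del: iter_i.simps)
  have carr: "y \<in> carrier (Dgrp K (Suc s) t)" if "y \<in> stage r (Suc s) t" for y r
    using subgroup.mem_carrier[OF stage_subgroup that] .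
  obtain y where y: "y \<in> stage n (Suc s) t" "imap K s t y = a"
    using lift by blast
  have "y \<in> stage r (Suc s) t" for r
  proof -
    define m where "m = max r n"
    obtain y' where y': "y' \<in> stage m (Suc s) t" "imap K s t y' = a"
      using lift by blast
    define d where "d = y \<otimes>\<^bsub>Dgrp K (Suc s) t\<^esub> inv\<^bsub>Dgrp K (Suc s) t\<^esub> y'"
    have "y' \<in> stage n (Suc s) t"
      using y'(1) stage_antimono[of n m] by (auto simp: m_def)
    then have d_n: "d \<in> stage n (Suc s) t"
      unfolding d_def using y(1) subgroup.m_closed[OF stage_subgroup]
        subgroup.m_inv_closed[OF stage_subgroup] by blast
    have "imap K s t d = \<one>\<^bsub>Dgrp K s t\<^esub>"
      using carr[OF y(1)] carr[OF y'(1)] y(2) y'(2) subgroup.mem_carrier[OF stage_subgroup a]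
      by (simp add: d_def)
    then obtain x where x: "x \<in> carrier (Egrp K s (t + 1))" "d = kmap K s (t + 1) x"
      using ker_i[of d s "t + 1"] carr[OF d_n] by auto
    have "x \<in> cycles K (n + 1) s (t + 1)"
      using x d_n by (simp add: cycles_eq_stage)
    then have "x \<in> cycles K (m + 1) s (t + 1)"
      unfolding cycles cycles_inf_def by auto
    then have "d \<in> stage m (Suc s) t"
      using x(2) by (simp add: cycles_eq_stage)
    moreover have "y = d \<otimes>\<^bsub>Dgrp K (Suc s) t\<^esub> y'"
      using carr[OF y(1)] carr[OF y'(1)] by (simp add: d_def D.m_assoc)
    ultimately have "y \<in> stage m (Suc s) t"
      using y'(1) subgroup.m_closed[OF stage_subgroup] by simp
    then show ?thesis
      using stage_antimono[of r m] by (auto simp: m_def)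
  qed
  then show ?thesis
    using y carr by blast
qed

text \<open>
  An element of all filtration stages lifts step by step to a compatible family in the tower of the
  \<open>D s t\<close>, and the inverse limit of that tower is trivial by hypothesis.
\<close>

lemma filtration_hausdorff:
  assumes cycles: "\<And>s. cycles K (n + 1) s (t + 1) = cycles_inf K s (t + 1)"
    and lim: "\<And>y. \<lbrakk>\<And>s. y s \<in> carrier (Dgrp K s t); \<And>s. imap K s t (y (Suc s)) = y s\<rbrakk>
      \<Longrightarrow> y 0 = \<one>\<^bsub>Dgrp K 0 t\<^esub>"
    and a: "\<And>s. a \<in> filtration K s t"
  shows "a = \<one>\<^bsub>Dgrp K 0 t\<^esub>"
proof -
  let ?P = "\<lambda>s y. y \<in> carrier (Dgrp K s t) \<and> (\<forall>r. y \<in> stage r s t) \<and> (s = 0 \<longrightarrow> y = a)"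
  have "\<exists>y. \<forall>s. ?P s (y s) \<and> imap K s t (y (Suc s)) = y s"
  proof (rule dependent_nat_choice)
    have "a \<in> carrier (Dgrp K 0 t)"
      using a[of 0] by (simp add: filtration_def)
    then show "\<exists>y. ?P 0 y"
      using a by (simp add: filtration_eq_stage)
    show "\<exists>y'. ?P (Suc s) y' \<and> imap K s t y' = y" if "?P s y" for y s
      using lift_stable_element[OF cycles, of y s] that by auto
  qed
  then obtain y where "\<And>s. ?P s (y s)" "\<And>s. imap K s t (y (Suc s)) = y s"
    by blast
  then show ?thesis
    using lim[of y] by auto
qed

text \<open>
  In row \<open>s \<ge> n\<close> every element of \<open>im j\<close> is a cycle on page \<open>n + 1\<close>, hence a boundary.
\<close>

lemma filtration_stationary:
  assumes "n \<le> s"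
    and page: "page_eq_page_inf K (n + 1)" and rows: "concentrated_in_first_rows K (n + 1) n"
  shows "filtration K s t \<subseteq> filtration K (Suc s) t"
proof
  have "boundaries K (n + 1) s t = cycles K (n + 1) s t"
  proof -
    have "carrier (page K (n + 1) s t) = {boundaries K (n + 1) s t}"
      using rows \<open>n \<le> s\<close> by (auto simp: concentrated_in_first_rows_def page_def)
    then show ?thesis
      unfolding page_def
      using E.carrier_Mod_eq_self_iff[OF cycles_subgroup boundaries_subgroup]
        boundaries_subset_im_j im_j_subset_cycles[of "n + 1" s t]
      by (metis le_add2 subset_trans)
  qed
  then have im_j: "im_j s t \<subseteq> boundaries_inf K s t"
    using page_eq_page_inf_imp(1)[OF page] im_j_subset_cycles[of "n + 1" s t] by simp
  fix a assume "a \<in> filtration K s t"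
  then obtain y where y: "y \<in> carrier (Dgrp K s t)" "a = iter_i K s 0 t y"
    by (auto simp: filtration_def)
  have "jmap K s t y \<in> boundaries_inf K s t"
    using im_j y(1) by (auto simp: im_j_def)
  then show "a \<in> filtration K (Suc s) t"
    using iter_i_mem_next_filtration_iff[OF y(1)] y(2) by simp
qed

text \<open>
  From stage \<open>n\<close> on the filtration is constant, so that stage \<open>n\<close> is the intersection of all stages.
\<close>

lemma filtration_vanishes:
  assumes page: "page_eq_page_inf K (n + 1)" and rows: "concentrated_in_first_rows K (n + 1) n"
    and lim: "\<And>y. \<lbrakk>\<And>s. y s \<in> carrier (Dgrp K s t); \<And>s. imap K s t (y (Suc s)) = y s\<rbrakk>
      \<Longrightarrow> y 0 = \<one>\<^bsub>Dgrp K 0 t\<^esub>"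
  shows "filtration K n t = {\<one>\<^bsub>Dgrp K 0 t\<^esub>}"
proof
  have above: "filtration K n t \<subseteq> filtration K (n + m) t" for m
    by (induction m) (use filtration_stationary[OF _ page rows] in \<open>auto simp: subset_iff\<close>)
  have below: "filtration K n t \<subseteq> filtration K m t" if "m \<le> n" for m
    unfolding filtration_eq_stage using that by (rule stage_antimono)
  have all: "filtration K n t \<subseteq> filtration K m t" for m
    using above[of "m - n"] below[of m] by (cases "m \<le> n") auto
  have "a = \<one>\<^bsub>Dgrp K 0 t\<^esub>" if "a \<in> filtration K n t" for a
  proof (rule filtration_hausdorff[of n t])
    show "cycles K (n + 1) s (t + 1) = cycles_inf K s (t + 1)" for s
      by (rule page_eq_page_inf_imp(2)[OF page])
    show "y 0 = \<one>\<^bsub>Dgrp K 0 t\<^esub>"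
      if "\<And>s. y s \<in> carrier (Dgrp K s t)" "\<And>s. imap K s t (y (Suc s)) = y s" for y
      using that by (rule lim)
  qed (use that all in blast)
  then show "filtration K n t \<subseteq> {\<one>\<^bsub>Dgrp K 0 t\<^esub>}"
    by blast
  show "{\<one>\<^bsub>Dgrp K 0 t\<^esub>} \<subseteq> filtration K n t"
    unfolding filtration_eq_stage using subgroup.one_closed[OF stage_subgroup] by simp
qed

end

section \<open>Additive and triangulated categories\<close>

lemma HomI: "f \<in> Arr C \<Longrightarrow> f \<in> Hom C (Dom C f) (Cod C f)"
  by (simp add: Hom_def)

lemma HomD:
  assumes "f \<in> Hom C X Y"
  shows "f \<in> Arr C" "Dom C f = X" "Cod C f = Y"
  using assms by (simp_all add: Hom_def)

lemma hom_group_simps [simp]: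
  "carrier (hom_group C X Y) = Hom C X Y"
  "f \<otimes>\<^bsub>hom_group C X Y\<^esub> g = add_arr C f g"
  "\<one>\<^bsub>hom_group C X Y\<^esub> = zero_arr C X Y"
  by (simp_all add: hom_group_def)

lemma inv_hom_group: "f \<in> Hom C X Y \<Longrightarrow> inv\<^bsub>hom_group C X Y\<^esub> f = neg_arr C f"
  by (simp add: neg_arr_def HomD)

lemma (in category) Hom_Obj:
  assumes "f \<in> Hom C X Y"
  shows "X \<in> Obj C" "Y \<in> Obj C"
  using assms Dom_Obj Cod_Obj by (auto simp: Hom_def)

context additive_category
begin

lemma Hom_comm_group:
  assumes "f \<in> Hom C X Y"
  shows "comm_group (hom_group C X Y)"
  using hom_comm_group Hom_Obj[OF assms] by blast

lemma zero_Hom: "\<lbrakk>X \<in> Obj C; Y \<in> Obj C\<rbrakk> \<Longrightarrow> zero_arr C X Y \<in> Hom C X Y"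
  using comm_group.axioms(2)[OF hom_comm_group, THEN group.is_monoid, THEN monoid.one_closed]
  by simp

lemma add_Hom: "\<lbrakk>f \<in> Hom C X Y; g \<in> Hom C X Y\<rbrakk> \<Longrightarrow> add_arr C f g \<in> Hom C X Y"
  using comm_group.axioms(2)[OF Hom_comm_group, THEN group.is_monoid, THEN monoid.m_closed]
  by simp

lemma neg_Hom: "f \<in> Hom C X Y \<Longrightarrow> neg_arr C f \<in> Hom C X Y"
  using comm_group.axioms(2)[OF Hom_comm_group, THEN group.inv_closed]
  by (simp flip: inv_hom_group)

lemma neg_neg: "f \<in> Hom C X Y \<Longrightarrow> neg_arr C (neg_arr C f) = f"
  using comm_group.axioms(2)[OF Hom_comm_group, THEN group.inv_inv, of f X Y f] neg_Hom
  by (simp add: inv_hom_group)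

lemma neg_zero: "\<lbrakk>X \<in> Obj C; Y \<in> Obj C\<rbrakk> \<Longrightarrow> neg_arr C (zero_arr C X Y) = zero_arr C X Y"
  using monoid.inv_one[OF group.is_monoid[OF comm_group.axioms(2)[OF hom_comm_group]], of X Y] zero_Hom
  by (simp add: inv_hom_group)

lemma precomp_group_hom:
  assumes "f \<in> Hom C X Y" "Z \<in> Obj C"
  shows "group_hom (hom_group C Y Z) (hom_group C X Z) (\<lambda>g. g \<cdot> f)"
proof -
  have "(\<lambda>g. g \<cdot> f) \<in> hom (hom_group C Y Z) (hom_group C X Z)"
    using assms comp_Hom comp_add_left by (auto simp: hom_def)
  then show ?thesis
    using hom_comm_group[THEN comm_group.axioms(2)] Hom_Obj[OF assms(1)] assms(2)
    by (simp add: group_hom_def group_hom_axioms_def)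
qed

lemma postcomp_group_hom:
  assumes "g \<in> Hom C Y Z" "X \<in> Obj C"
  shows "group_hom (hom_group C X Y) (hom_group C X Z) (\<lambda>f. g \<cdot> f)"
proof -
  have "(\<lambda>f. g \<cdot> f) \<in> hom (hom_group C X Y) (hom_group C X Z)"
    using assms comp_Hom comp_add_right by (auto simp: hom_def)
  then show ?thesis
    using hom_comm_group[THEN comm_group.axioms(2)] Hom_Obj[OF assms(1)] assms(2)
    by (simp add: group_hom_def group_hom_axioms_def)
qed

lemma zero_comp: "\<lbrakk>f \<in> Hom C X Y; Z \<in> Obj C\<rbrakk> \<Longrightarrow> zero_arr C Y Z \<cdot> f = zero_arr C X Z"
  using group_hom.hom_one[OF precomp_group_hom] by simp

lemma comp_zero: "\<lbrakk>g \<in> Hom C Y Z; X \<in> Obj C\<rbrakk> \<Longrightarrow> g \<cdot> zero_arr C X Y = zero_arr C X Z"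
  using group_hom.hom_one[OF postcomp_group_hom] by simp

lemma neg_comp: "\<lbrakk>f \<in> Hom C X Y; g \<in> Hom C Y Z\<rbrakk> \<Longrightarrow> neg_arr C g \<cdot> f = neg_arr C (g \<cdot> f)"
  using group_hom.hom_inv[OF precomp_group_hom, of f X Y Z g] comp_Hom[of f X Y g Z] Hom_Obj
  by (simp add: inv_hom_group)

lemma comp_neg: "\<lbrakk>f \<in> Hom C X Y; g \<in> Hom C Y Z\<rbrakk> \<Longrightarrow> g \<cdot> neg_arr C f = neg_arr C (g \<cdot> f)"
  using group_hom.hom_inv[OF postcomp_group_hom, of g Y Z X f] comp_Hom[of f X Y g Z] Hom_Obj
  by (simp add: inv_hom_group)

lemma neg_eq_zero_iff:
  assumes "f \<in> Hom C X Y"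
  shows "neg_arr C f = zero_arr C X Y \<longleftrightarrow> f = zero_arr C X Y"
  using neg_neg[OF assms] neg_zero Hom_Obj[OF assms] by metis

lemma Hom_to_zero:
  assumes "zero_object C Z" "f \<in> Hom C X Z"
  shows "f = zero_arr C X Z"
  using assms zero_Hom[of X Z] Hom_Obj[OF assms(2)] unfolding zero_object_def by blast

lemma Hom_from_zero:
  assumes "zero_object C Z" "f \<in> Hom C Z X"
  shows "f = zero_arr C Z X"
  using assms zero_Hom[of Z X] Hom_Obj[OF assms(2)] unfolding zero_object_def by blast

lemma zero_objectI:
  assumes "X \<in> Obj C" "id_arr C X = zero_arr C X X"
  shows "zero_object C X"
  unfolding zero_object_def
proof (intro conjI ballI ex_ex1I)
  fix Y assume Y: "Y \<in> Obj C"
  show "\<exists>f. f \<in> Hom C X Y" "\<exists>f. f \<in> Hom C Y X"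
    using zero_Hom assms(1) Y by blast+
  have "f = zero_arr C X Y" if "f \<in> Hom C X Y" for f
    using id_right[OF that] comp_zero[OF that assms(1)] assms(2) by simp
  then show "f = g" if "f \<in> Hom C X Y" "g \<in> Hom C X Y" for f g
    using that by metis
  have "f = zero_arr C Y X" if "f \<in> Hom C Y X" for f
    using id_left[OF that] zero_comp[OF that assms(1)] assms(2) by simp
  then show "f = g" if "f \<in> Hom C Y X" "g \<in> Hom C Y X" for f g
    using that by metis
qed (rule assms)

end

context triangulated_category
begin

lemma susp_Obj: "X \<in> Obj C \<Longrightarrow> susp_obj C X \<in> Obj C"
  using susp_obj_bij by (auto simp: bij_betw_def)

lemma desusp_Obj: "X \<in> Obj C \<Longrightarrow> desusp_obj C X \<in> Obj C"
  unfolding desusp_obj_def using susp_obj_bij by (metis bij_betw_def inv_into_into)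

lemma susp_desusp_obj: "X \<in> Obj C \<Longrightarrow> susp_obj C (desusp_obj C X) = X"
  unfolding desusp_obj_def using susp_obj_bij by (simp add: bij_betw_def f_inv_into_f)

lemma desusp_susp_obj: "X \<in> Obj C \<Longrightarrow> desusp_obj C (susp_obj C X) = X"
  unfolding desusp_obj_def using susp_obj_bij by (simp add: bij_betw_def inv_into_f_f)

lemma susp_desusp_arr: "f \<in> Arr C \<Longrightarrow> susp_arr C (desusp_arr C f) = f"
  unfolding desusp_arr_def using susp_arr_bij by (simp add: bij_betw_def f_inv_into_f)

lemma desusp_susp_arr: "f \<in> Arr C \<Longrightarrow> desusp_arr C (susp_arr C f) = f"
  unfolding desusp_arr_def using susp_arr_bij by (simp add: bij_betw_def inv_into_f_f)

lemma desusp_Hom: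
  assumes "f \<in> Hom C X Y"
  shows "desusp_arr C f \<in> Hom C (desusp_obj C X) (desusp_obj C Y)"
proof -
  let ?g = "desusp_arr C f"
  have g: "?g \<in> Arr C"
    unfolding desusp_arr_def using HomD(1)[OF assms] susp_arr_bij
    by (metis bij_betw_def inv_into_into)
  then have "f \<in> Hom C (susp_obj C (Dom C ?g)) (susp_obj C (Cod C ?g))"
    using susp_Hom[OF HomI[OF g]] susp_desusp_arr[OF HomD(1)[OF assms]] by simp
  then have "X = susp_obj C (Dom C ?g)" "Y = susp_obj C (Cod C ?g)"
    using HomD(2,3)[OF assms] by (simp_all add: Hom_def)
  then have "desusp_obj C X = Dom C ?g" "desusp_obj C Y = Cod C ?g"
    using desusp_susp_obj Dom_Obj[OF g] Cod_Obj[OF g] by simp_all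
  then show ?thesis
    using HomI[OF g] by simp
qed

lemma susp_inj: "\<lbrakk>f \<in> Arr C; g \<in> Arr C; susp_arr C f = susp_arr C g\<rbrakk> \<Longrightarrow> f = g"
  using desusp_susp_arr by metis

lemma desusp_comp:
  assumes "f \<in> Hom C X Y" "g \<in> Hom C Y Z"
  shows "desusp_arr C (g \<cdot> f) = desusp_arr C g \<cdot> desusp_arr C f"
proof (rule susp_inj)
  show "desusp_arr C (g \<cdot> f) \<in> Arr C" "desusp_arr C g \<cdot> desusp_arr C f \<in> Arr C"
    using desusp_Hom comp_Hom assms HomD(1) by metis+
  show "susp_arr C (desusp_arr C (g \<cdot> f)) = susp_arr C (desusp_arr C g \<cdot> desusp_arr C f)"
    using susp_comp[OF desusp_Hom[OF assms(1)] desusp_Hom[OF assms(2)]] assms comp_Hom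
      susp_desusp_arr HomD(1) by metis
qed

lemma desusp_id: "X \<in> Obj C \<Longrightarrow> desusp_arr C (id_arr C X) = id_arr C (desusp_obj C X)"
  using susp_id[OF desusp_Obj] desusp_susp_arr HomD(1) id_Hom desusp_Obj susp_desusp_obj by metis

lemma susp_group_hom:
  assumes "X \<in> Obj C" "Y \<in> Obj C"
  shows "group_hom (hom_group C X Y) (hom_group C (susp_obj C X) (susp_obj C Y)) (susp_arr C)"
proof -
  have "susp_arr C \<in> hom (hom_group C X Y) (hom_group C (susp_obj C X) (susp_obj C Y))"
    using susp_Hom susp_add by (auto simp: hom_def)
  then show ?thesis
    using hom_comm_group[THEN comm_group.axioms(2)] assms susp_Obj
    by (simp add: group_hom_def group_hom_axioms_def)
qed

lemma susp_zero:
  "\<lbrakk>X \<in> Obj C; Y \<in> Obj C\<rbrakk> \<Longrightarrow> susp_arr C (zero_arr C X Y) = zero_arr C (susp_obj C X) (susp_obj C Y)"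
  using group_hom.hom_one[OF susp_group_hom] by simp

lemma susp_neg:
  assumes "f \<in> Hom C X Y"
  shows "susp_arr C (neg_arr C f) = neg_arr C (susp_arr C f)"
  using group_hom.hom_inv[OF susp_group_hom, of X Y f] assms Hom_Obj[OF assms] susp_Hom[OF assms]
  by (simp add: inv_hom_group)

lemma desusp_zero:
  assumes "X \<in> Obj C" "Y \<in> Obj C"
  shows "desusp_arr C (zero_arr C X Y) = zero_arr C (desusp_obj C X) (desusp_obj C Y)"
  using susp_zero[OF desusp_Obj[OF assms(1)] desusp_Obj[OF assms(2)]] assms
    desusp_susp_arr[OF HomD(1)[OF zero_Hom[OF desusp_Obj[OF assms(1)] desusp_Obj[OF assms(2)]]]]
  by (simp add: susp_desusp_obj)

lemma zero_object_susp:
  assumes "zero_object C Z"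
  shows "zero_object C (susp_obj C Z)"
proof -
  have Z: "Z \<in> Obj C"
    using assms by (simp add: zero_object_def)
  have "id_arr C Z = zero_arr C Z Z"
    using Hom_to_zero[OF assms id_Hom[OF Z]] .
  then show ?thesis
    using zero_objectI susp_Obj Z susp_id susp_zero by metis
qed

lemma triangleE:
  assumes "(u, v, w) \<in> Tri C"
  obtains A B D where "u \<in> Hom C A B" "v \<in> Hom C B D" "w \<in> Hom C D (susp_obj C A)"
  using Tri_candidate[OF assms] by (auto simp: candidate_triangle_def Hom_def)

lemma triangle_Hom:
  assumes "(u, v, w) \<in> Tri C" "u \<in> Hom C A B" "v \<in> Hom C B D"
  shows "w \<in> Hom C D (susp_obj C A)"
  using Tri_candidate[OF assms(1)] assms(2,3) by (auto simp: candidate_triangle_def Hom_def)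

lemma rotate_iff:
  assumes "u \<in> Hom C A B" "v \<in> Hom C B D" "w \<in> Hom C D (susp_obj C A)"
  shows "(u, v, w) \<in> Tri C \<longleftrightarrow> (v, w, neg_arr C (susp_arr C u)) \<in> Tri C"
  using assms by (intro TR2) (auto simp: candidate_triangle_def Hom_def)

lemma rotate:
  assumes "(u, v, w) \<in> Tri C"
  shows "(v, w, neg_arr C (susp_arr C u)) \<in> Tri C"
  using TR2[OF Tri_candidate[OF assms]] assms by simp

text \<open>
  Map the triangle of the identity of \<open>A\<close>, whose cone is zero, to the given triangle.
\<close>

lemma triangle_comp_zero:
  assumes "(u, v, w) \<in> Tri C" "u \<in> Hom C A B" "v \<in> Hom C B D"
  shows "v \<cdot> u = zero_arr C A D"
proof -
  obtain Z where Z: "zero_object C Z" using ex_zero_object by blast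
  then have ZO: "Z \<in> Obj C" by (simp add: zero_object_def)
  note obj = Hom_Obj[OF assms(2)] Hom_Obj[OF assms(3)]
  have zero: "zero_arr C A Z \<in> Hom C A Z" "zero_arr C Z (susp_obj C A) \<in> Hom C Z (susp_obj C A)"
    using zero_Hom obj ZO susp_Obj by blast+
  have "\<exists>c \<in> Hom C (Dom C (zero_arr C Z (susp_obj C A))) (Dom C w).
      v \<cdot> u = c \<cdot> zero_arr C A Z \<and> w \<cdot> c = susp_arr C (id_arr C A) \<cdot> zero_arr C Z (susp_obj C A)"
    using assms zero obj id_Hom
    by (intro TR3[OF TR1_id[OF obj(1) Z] assms(1)]) (auto simp: HomD HomD(2)[OF id_Hom])
  then obtain c where "c \<in> Hom C Z D" "v \<cdot> u = c \<cdot> zero_arr C A Z"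
    using HomD(2)[OF zero(2)] HomD(2)[OF triangle_Hom[OF assms]] by auto
  then show ?thesis
    using comp_zero obj by simp
qed

lemma triangle_zero_id:
  assumes "zero_object C Z" "Y \<in> Obj C"
  shows "(zero_arr C Z Y, id_arr C Y, zero_arr C Y (susp_obj C Z)) \<in> Tri C"
proof -
  have Z: "Z \<in> Obj C" "susp_obj C Z \<in> Obj C"
    using assms(1) susp_Obj by (auto simp: zero_object_def)
  have "(id_arr C Y, zero_arr C Y (susp_obj C Z), zero_arr C (susp_obj C Z) (susp_obj C Y)) \<in> Tri C"
    using TR1_id[OF assms(2) zero_object_susp[OF assms(1)]] .
  then show ?thesis
    using rotate_iff[of "zero_arr C Z Y" Z Y "id_arr C Y" Y "zero_arr C Y (susp_obj C Z)"]
      zero_Hom id_Hom Z assms susp_Obj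
    by (simp add: susp_zero neg_zero)
qed

text \<open>
  A map \<open>g\<close> that kills \<open>u\<close> is the middle part of a morphism from the given triangle to the triangle
  \<open>0 \<rightarrow> Y \<rightarrow> Y\<close>; its third part is the factorisation.
\<close>

lemma weak_cokernel:
  assumes tri: "(u, v, w) \<in> Tri C" and u: "u \<in> Hom C A B" and v: "v \<in> Hom C B D"
    and g: "g \<in> Hom C B Y" and gu: "g \<cdot> u = zero_arr C A Y"
  shows "\<exists>h \<in> Hom C D Y. g = h \<cdot> v"
proof -
  obtain Z where Z: "zero_object C Z" using ex_zero_object by blast
  then have ZO: "Z \<in> Obj C" by (simp add: zero_object_def)
  note obj = Hom_Obj[OF u] Hom_Obj[OF v] Hom_Obj[OF g]
  have zero: "zero_arr C A Z \<in> Hom C A Z" "zero_arr C Z Y \<in> Hom C Z Y"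
      "zero_arr C Y (susp_obj C Z) \<in> Hom C Y (susp_obj C Z)"
    using zero_Hom obj ZO susp_Obj by blast+
  have "\<exists>c \<in> Hom C (Dom C w) (Dom C (zero_arr C Y (susp_obj C Z))).
      id_arr C Y \<cdot> g = c \<cdot> v \<and> zero_arr C Y (susp_obj C Z) \<cdot> c = susp_arr C (zero_arr C A Z) \<cdot> w"
  proof (rule TR3[OF tri triangle_zero_id[OF Z obj(6)]])
    show "zero_arr C A Z \<in> Hom C (Dom C u) (Dom C (zero_arr C Z Y))"
      using zero u by (simp add: HomD)
    show "g \<in> Hom C (Dom C v) (Dom C (id_arr C Y))"
      using v g id_Hom[OF obj(6)] by (simp add: HomD)
    show "zero_arr C Z Y \<cdot> zero_arr C A Z = g \<cdot> u"
      using comp_zero[OF zero(2) obj(1)] gu by simp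
  qed
  then show ?thesis
    using HomD(2)[OF triangle_Hom[OF tri u v]] HomD(2)[OF zero(3)] id_left[OF g] by auto
qed

text \<open>
  Complete \<open>h\<close> to a morphism from the rotated triangle \<open>T \<rightarrow> 0 \<rightarrow> \<Sigma>T\<close> to the rotated given triangle;
  its third part is the suspension of the factorisation.
\<close>

lemma weak_kernel:
  assumes tri: "(u, v, w) \<in> Tri C" and u: "u \<in> Hom C A B" and v: "v \<in> Hom C B D"
    and h: "h \<in> Hom C T B" and vh: "v \<cdot> h = zero_arr C T D"
  shows "\<exists>h' \<in> Hom C T A. h = u \<cdot> h'"
proof -
  obtain Z where Z: "zero_object C Z" using ex_zero_object by blast
  then have ZO: "Z \<in> Obj C" by (simp add: zero_object_def)
  note obj = Hom_Obj[OF u] Hom_Obj[OF v] Hom_Obj[OF h]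
  note w = triangle_Hom[OF tri u v]
  have zero: "zero_arr C T Z \<in> Hom C T Z" "zero_arr C Z D \<in> Hom C Z D"
      "zero_arr C Z (susp_obj C T) \<in> Hom C Z (susp_obj C T)"
    using zero_Hom obj ZO susp_Obj by blast+
  have sid: "susp_arr C (id_arr C T) \<in> Hom C (susp_obj C T) (susp_obj C T)"
    using susp_Hom[OF id_Hom[OF obj(5)]] .
  have su: "susp_arr C u \<in> Hom C (susp_obj C A) (susp_obj C B)"
    using susp_Hom[OF u] .
  have "\<exists>c \<in> Hom C (Dom C (neg_arr C (susp_arr C (id_arr C T)))) (Dom C (neg_arr C (susp_arr C u))).
      w \<cdot> zero_arr C Z D = c \<cdot> zero_arr C Z (susp_obj C T) \<and>
      neg_arr C (susp_arr C u) \<cdot> c = susp_arr C h \<cdot> neg_arr C (susp_arr C (id_arr C T))"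
  proof (rule TR3[OF rotate[OF TR1_id[OF obj(5) Z]] rotate[OF tri]])
    show "h \<in> Hom C (Dom C (zero_arr C T Z)) (Dom C v)"
      using zero h v by (simp add: HomD)
    show "zero_arr C Z D \<in> Hom C (Dom C (zero_arr C Z (susp_obj C T))) (Dom C w)"
      using zero w by (simp add: HomD)
    show "v \<cdot> h = zero_arr C Z D \<cdot> zero_arr C T Z"
      using comp_zero[OF zero(2) obj(5)] vh by simp
  qed
  then obtain c where c: "c \<in> Hom C (susp_obj C T) (susp_obj C A)"
      "neg_arr C (susp_arr C u) \<cdot> c = susp_arr C h \<cdot> neg_arr C (susp_arr C (id_arr C T))"
    using HomD(2)[OF neg_Hom[OF sid]] HomD(2)[OF neg_Hom[OF su]] by auto
  have sh: "susp_arr C h \<in> Hom C (susp_obj C T) (susp_obj C B)"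
    using susp_Hom[OF h] .
  have "neg_arr C (susp_arr C u \<cdot> c) = neg_arr C (susp_arr C h)"
    using c neg_comp[OF c(1) su] comp_neg[OF sid sh] id_right[OF sh] susp_id[OF obj(5)] by simp
  then have eq: "susp_arr C u \<cdot> c = susp_arr C h"
    using neg_neg comp_Hom[OF c(1) su] sh by metis
  define h' where "h' = desusp_arr C c"
  have h': "h' \<in> Hom C T A" "susp_arr C h' = c"
    using desusp_Hom[OF c(1)] desusp_susp_obj obj susp_desusp_arr HomD(1)[OF c(1)]
    by (simp_all add: h'_def)
  then have "susp_arr C (u \<cdot> h') = susp_arr C h"
    using susp_comp[OF h'(1) u] eq by simp
  then have "u \<cdot> h' = h"
    using susp_inj HomD(1)[OF comp_Hom[OF h'(1) u]] HomD(1)[OF h] by blast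
  then show ?thesis
    using h'(1) by auto
qed

text \<open>
  Rotating three times suspends a triangle and changes all three signs.
\<close>

lemma desusp_triangle:
  assumes tri: "(u, v, w) \<in> Tri C" and u: "u \<in> Hom C A B" and v: "v \<in> Hom C B D"
  shows "(neg_arr C (desusp_arr C u), neg_arr C (desusp_arr C v), neg_arr C (desusp_arr C w)) \<in> Tri C"
proof -
  note obj = Hom_Obj[OF u] Hom_Obj[OF v]
  have w: "w \<in> Hom C D (susp_obj C A)"
    using triangle_Hom[OF tri u v] .
  let ?A = "desusp_obj C A" and ?B = "desusp_obj C B" and ?D = "desusp_obj C D"
  let ?u = "neg_arr C (desusp_arr C u)" and ?v = "neg_arr C (desusp_arr C v)"
    and ?w = "neg_arr C (desusp_arr C w)"
  have Hom: "?u \<in> Hom C ?A ?B" "?v \<in> Hom C ?B ?D" "?w \<in> Hom C ?D (susp_obj C ?A)"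
    using neg_Hom[OF desusp_Hom[OF u]] neg_Hom[OF desusp_Hom[OF v]] neg_Hom[OF desusp_Hom[OF w]] obj
    by (simp_all add: susp_desusp_obj desusp_susp_obj)
  have neg: "neg_arr C (susp_arr C (neg_arr C (desusp_arr C f))) = f" if "f \<in> Hom C X Y" for f X Y
    using susp_neg[OF desusp_Hom[OF that]] susp_desusp_arr[OF HomD(1)[OF that]] neg_neg[OF that]
    by simp
  have "(?u, ?v, ?w) \<in> Tri C \<longleftrightarrow> (?v, ?w, u) \<in> Tri C"
    using rotate_iff[OF Hom] neg[OF u] by simp
  also have "\<dots> \<longleftrightarrow> (?w, u, v) \<in> Tri C"
    using rotate_iff[OF Hom(2,3), of u] u neg[OF v] obj by (simp add: susp_desusp_obj)
  also have "\<dots> \<longleftrightarrow> (u, v, w) \<in> Tri C"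
    using rotate_iff[OF Hom(3), of u B v] u v neg[OF w] obj by (simp add: susp_desusp_obj)
  finally show ?thesis
    using tri by simp
qed

end

section \<open>Shifts and the exactness of the Adams couple\<close>

context triangulated_category
begin

text \<open>
  For \<open>n = 0\<close> the shift is defined by the other branch; both branches are the identity there.
\<close>

lemma shift_uminus_int:
  "shift_obj C (- int n) = desusp_obj C ^^ n" "shift_arr C (- int n) = desusp_arr C ^^ n"
  by (cases n; simp add: shift_obj_def shift_arr_def nat_add_distrib)+

lemma shift_Obj: "X \<in> Obj C \<Longrightarrow> shift_obj C t X \<in> Obj C"
proof -
  have "(susp_obj C ^^ n) X \<in> Obj C" "(desusp_obj C ^^ n) X \<in> Obj C" if "X \<in> Obj C" for n X
    using that by (induction n) (auto simp: susp_Obj desusp_Obj)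
  then show "X \<in> Obj C \<Longrightarrow> shift_obj C t X \<in> Obj C"
    by (simp add: shift_obj_def)
qed

lemma shift_Hom:
  assumes "f \<in> Hom C X Y"
  shows "shift_arr C t f \<in> Hom C (shift_obj C t X) (shift_obj C t Y)"
proof -
  have "(susp_arr C ^^ n) f \<in> Hom C ((susp_obj C ^^ n) X) ((susp_obj C ^^ n) Y)"
    "(desusp_arr C ^^ n) f \<in> Hom C ((desusp_obj C ^^ n) X) ((desusp_obj C ^^ n) Y)" for n
    using assms by (induction n) (auto simp: susp_Hom desusp_Hom)
  then show ?thesis
    by (simp add: shift_obj_def shift_arr_def)
qed

lemma shift_comp:
  assumes "f \<in> Hom C X Y" "g \<in> Hom C Y Z"
  shows "shift_arr C t (g \<cdot> f) = shift_arr C t g \<cdot> shift_arr C t f"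
proof -
  have susp: "(susp_arr C ^^ n) (g \<cdot> f) = (susp_arr C ^^ n) g \<cdot> (susp_arr C ^^ n) f" for n
  proof (induction n)
    case (Suc n)
    show ?case
      using Suc susp_comp shift_Hom[OF assms(1), of "int n"] shift_Hom[OF assms(2), of "int n"]
      by (simp add: shift_obj_def shift_arr_def)
  qed simp
  have desusp: "(desusp_arr C ^^ n) (g \<cdot> f) = (desusp_arr C ^^ n) g \<cdot> (desusp_arr C ^^ n) f" for n
  proof (induction n)
    case (Suc n)
    show ?case
      using Suc desusp_comp shift_Hom[OF assms(1), of "- int n"] shift_Hom[OF assms(2), of "- int n"]
      by (simp add: shift_uminus_int)
  qed simp
  show ?thesis
    by (simp add: shift_arr_def susp desusp)
qed

lemma shift_id:
  assumes "X \<in> Obj C"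
  shows "shift_arr C t (id_arr C X) = id_arr C (shift_obj C t X)"
proof -
  have susp: "(susp_arr C ^^ n) (id_arr C X) = id_arr C ((susp_obj C ^^ n) X)" for n
  proof (induction n)
    case (Suc n)
    show ?case
      using Suc susp_id shift_Obj[OF assms, of "int n"] by (simp add: shift_obj_def)
  qed simp
  have desusp: "(desusp_arr C ^^ n) (id_arr C X) = id_arr C ((desusp_obj C ^^ n) X)" for n
  proof (induction n)
    case (Suc n)
    show ?case
      using Suc desusp_id shift_Obj[OF assms, of "- int n"] assms
      by (simp add: shift_uminus_int)
  qed simp
  show ?thesis
    by (simp add: shift_arr_def shift_obj_def susp desusp)
qed

lemma shift_zero:
  assumes "X \<in> Obj C" "Y \<in> Obj C"
  shows "shift_arr C t (zero_arr C X Y) = zero_arr C (shift_obj C t X) (shift_obj C t Y)"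
proof -
  have susp: "(susp_arr C ^^ n) (zero_arr C X Y) =
      zero_arr C ((susp_obj C ^^ n) X) ((susp_obj C ^^ n) Y)" for n
  proof (induction n)
    case (Suc n)
    show ?case
      using Suc susp_zero shift_Obj[OF assms(1), of "int n"] shift_Obj[OF assms(2), of "int n"]
      by (simp add: shift_obj_def)
  qed simp
  have desusp: "(desusp_arr C ^^ n) (zero_arr C X Y) =
      zero_arr C ((desusp_obj C ^^ n) X) ((desusp_obj C ^^ n) Y)" for n
  proof (induction n)
    case (Suc n)
    show ?case
      using Suc desusp_zero shift_Obj[OF assms(1), of "- int n"] shift_Obj[OF assms(2), of "- int n"]
        assms
      by (simp add: shift_uminus_int)
  qed simp
  show ?thesis
    by (simp add: shift_arr_def shift_obj_def susp desusp)
qed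

lemma shift_uminus_obj:
  assumes "X \<in> Obj C"
  shows "shift_obj C t (shift_obj C (- t) X) = X"
proof -
  have "(susp_obj C ^^ n) ((desusp_obj C ^^ n) X) = X" if "X \<in> Obj C" for n X
    using that
  proof (induction n arbitrary: X)
    case (Suc n)
    have "(susp_obj C ^^ Suc n) ((desusp_obj C ^^ Suc n) X) =
        susp_obj C ((susp_obj C ^^ n) ((desusp_obj C ^^ n) (desusp_obj C X)))"
      by (simp add: funpow_swap1)
    then show ?case
      using Suc desusp_Obj susp_desusp_obj by simp
  qed simp
  moreover have "(desusp_obj C ^^ n) ((susp_obj C ^^ n) X) = X" if "X \<in> Obj C" for n X
    using that
  proof (induction n arbitrary: X)
    case (Suc n)
    have "(desusp_obj C ^^ Suc n) ((susp_obj C ^^ Suc n) X) =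
        desusp_obj C ((desusp_obj C ^^ n) ((susp_obj C ^^ n) (susp_obj C X)))"
      by (simp add: funpow_swap1)
    then show ?case
      using Suc susp_Obj desusp_susp_obj by simp
  qed simp
  ultimately show ?thesis
    using assms by (simp add: shift_obj_def)
qed

lemma shift_uminus_arr:
  assumes "f \<in> Arr C"
  shows "shift_arr C t (shift_arr C (- t) f) = f"
proof -
  have susp_Arr: "susp_arr C f \<in> Arr C" and desusp_Arr: "desusp_arr C f \<in> Arr C"
    if "f \<in> Arr C" for f
    using susp_Hom[OF HomI[OF that]] desusp_Hom[OF HomI[OF that]] by (simp_all add: HomD)
  have "(susp_arr C ^^ n) ((desusp_arr C ^^ n) f) = f" if "f \<in> Arr C" for n f
    using that
  proof (induction n arbitrary: f)
    case (Suc n)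
    have "(susp_arr C ^^ Suc n) ((desusp_arr C ^^ Suc n) f) =
        susp_arr C ((susp_arr C ^^ n) ((desusp_arr C ^^ n) (desusp_arr C f)))"
      by (simp add: funpow_swap1)
    then show ?case
      using Suc desusp_Arr susp_desusp_arr by simp
  qed simp
  moreover have "(desusp_arr C ^^ n) ((susp_arr C ^^ n) f) = f" if "f \<in> Arr C" for n f
    using that
  proof (induction n arbitrary: f)
    case (Suc n)
    have "(desusp_arr C ^^ Suc n) ((susp_arr C ^^ Suc n) f) =
        desusp_arr C ((desusp_arr C ^^ n) ((susp_arr C ^^ n) (susp_arr C f)))"
      by (simp add: funpow_swap1)
    then show ?case
      using Suc susp_Arr desusp_susp_arr by simp
  qed simp
  ultimately show ?thesis
    using assms by (simp add: shift_arr_def)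
qed

lemma shift_susp_obj:
  assumes "X \<in> Obj C"
  shows "shift_obj C (t - 1) (susp_obj C X) = shift_obj C t X"
proof (cases "0 < t")
  case True
  then have "nat t = Suc (nat (t - 1))" by simp
  with True show ?thesis
    by (simp add: shift_obj_def funpow_swap1)
next
  case False
  then have "nat (1 - t) = Suc (nat (- t))" by simp
  with False show ?thesis
    using desusp_susp_obj[OF assms] by (simp add: shift_obj_def funpow_swap1)
qed

lemma shift_susp_arr:
  assumes "f \<in> Arr C"
  shows "shift_arr C (t - 1) (susp_arr C f) = shift_arr C t f"
proof (cases "0 < t")
  case True
  then have "nat t = Suc (nat (t - 1))" by simp
  with True show ?thesis
    by (simp add: shift_arr_def funpow_swap1)
next
  case False
  then have "nat (1 - t) = Suc (nat (- t))" by simp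
  with False show ?thesis
    using desusp_susp_arr[OF assms] by (simp add: shift_arr_def funpow_swap1)
qed

text \<open>
  Exactness of \<open>Hom(D, Y) \<rightarrow> Hom(B, Y) \<rightarrow> Hom(A, Y)\<close> for all \<open>Y\<close>. It does not see the sign of \<open>u\<close> or
  \<open>v\<close>, unlike membership in an exact triangle.
\<close>

definition coexact :: "'o \<Rightarrow> 'o \<Rightarrow> 'o \<Rightarrow> 'm \<Rightarrow> 'm \<Rightarrow> bool" where
  "coexact A B D u v \<longleftrightarrow> u \<in> Hom C A B \<and> v \<in> Hom C B D \<and>
     (\<forall>Y \<in> Obj C. \<forall>g \<in> Hom C B Y.
        g \<cdot> u = zero_arr C A Y \<longleftrightarrow> g \<in> (\<lambda>h. h \<cdot> v) ` Hom C D Y)"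

lemma triangle_coexact:
  assumes tri: "(u, v, w) \<in> Tri C" and u: "u \<in> Hom C A B" and v: "v \<in> Hom C B D"
  shows "coexact A B D u v"
  unfolding coexact_def
proof (intro conjI ballI u v)
  fix Y g assume Y: "Y \<in> Obj C" and g: "g \<in> Hom C B Y"
  show "g \<cdot> u = zero_arr C A Y \<longleftrightarrow> g \<in> (\<lambda>h. h \<cdot> v) ` Hom C D Y"
  proof
    show "g \<in> (\<lambda>h. h \<cdot> v) ` Hom C D Y" if "g \<cdot> u = zero_arr C A Y"
      using weak_cokernel[OF tri u v g that] by blast
    show "g \<cdot> u = zero_arr C A Y" if "g \<in> (\<lambda>h. h \<cdot> v) ` Hom C D Y"
    proof -
      from that obtain h where h: "h \<in> Hom C D Y" "g = h \<cdot> v" by blast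
      have "g \<cdot> u = h \<cdot> (v \<cdot> u)"
        using comp_assoc[OF u v h(1)] h(2) by simp
      then show ?thesis
        using triangle_comp_zero[OF tri u v] comp_zero[OF h(1)] Hom_Obj[OF u] by simp
    qed
  qed
qed

text \<open>
  The rotated triangle contains the negative of the suspension of \<open>u\<close>; the sign is moved to the map
  that is composed with it.
\<close>

lemma triangle_coexact_susp:
  assumes tri: "(u, v, w) \<in> Tri C" and u: "u \<in> Hom C A B" and v: "v \<in> Hom C B D"
  shows "coexact D (susp_obj C A) (susp_obj C B) w (susp_arr C u)"
proof -
  have w: "w \<in> Hom C D (susp_obj C A)"
    using triangle_Hom[OF tri u v] .
  have su: "susp_arr C u \<in> Hom C (susp_obj C A) (susp_obj C B)"
    using susp_Hom[OF u] .
  have "(\<lambda>h. h \<cdot> neg_arr C (susp_arr C u)) ` Hom C (susp_obj C B) Y =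
      (\<lambda>h. h \<cdot> susp_arr C u) ` Hom C (susp_obj C B) Y" for Y
  proof -
    have "h \<cdot> neg_arr C (susp_arr C u) = neg_arr C h \<cdot> susp_arr C u"
      "h \<cdot> susp_arr C u = neg_arr C h \<cdot> neg_arr C (susp_arr C u)"
      if h: "h \<in> Hom C (susp_obj C B) Y" for h
      using comp_neg[OF su h] neg_comp[OF su h] comp_neg[OF su neg_Hom[OF h]]
        neg_neg[OF comp_Hom[OF su h]] by simp_all
    then show ?thesis
      using neg_Hom by (intro antisym subsetI; elim imageE) (metis imageI)+
  qed
  then show ?thesis
    using triangle_coexact[OF rotate[OF rotate[OF tri]] w neg_Hom[OF su]] su
    unfolding coexact_def by simp
qed

text \<open>
  The shift is an automorphism of the category, so exactness against \<open>Y\<close> after shifting by \<open>t\<close> is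
  exactness against \<open>Y\<close> shifted by \<open>-t\<close> before.
\<close>

lemma coexact_shift:
  assumes "coexact A B D u v"
  shows "coexact (shift_obj C t A) (shift_obj C t B) (shift_obj C t D) (shift_arr C t u) (shift_arr C t v)"
proof -
  have u: "u \<in> Hom C A B" and v: "v \<in> Hom C B D"
    using assms by (auto simp: coexact_def)
  note obj = Hom_Obj[OF u] Hom_Obj[OF v]
  have "g \<cdot> shift_arr C t u = zero_arr C (shift_obj C t A) Y \<longleftrightarrow>
      g \<in> (\<lambda>h. h \<cdot> shift_arr C t v) ` Hom C (shift_obj C t D) Y"
    if Y: "Y \<in> Obj C" and g: "g \<in> Hom C (shift_obj C t B) Y" for Y g
  proof -
    define Y' g' where "Y' = shift_obj C (- t) Y" and "g' = shift_arr C (- t) g"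
    have Y': "Y' \<in> Obj C" "shift_obj C t Y' = Y"
      using Y shift_Obj shift_uminus_obj by (simp_all add: Y'_def)
    have unshift: "shift_arr C (- t) h \<in> Hom C E Y'" "shift_arr C t (shift_arr C (- t) h) = h"
      if "h \<in> Hom C (shift_obj C t E) Y" "E \<in> Obj C" for h E
      using shift_Hom[OF that(1), of "- t"] shift_uminus_obj[OF that(2), of "- t"]
        shift_uminus_arr[OF HomD(1)[OF that(1)]] by (simp_all add: Y'_def)
    have g': "g' \<in> Hom C B Y'" "shift_arr C t g' = g"
      using unshift[OF g obj(2)] by (simp_all add: g'_def)
    have "g \<cdot> shift_arr C t u = shift_arr C t (g' \<cdot> u)"
      using shift_comp[OF u g'(1)] g'(2) by simp
    moreover have "zero_arr C (shift_obj C t A) Y = shift_arr C t (zero_arr C A Y')"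
      using shift_zero obj Y' by simp
    moreover have "shift_arr C t (g' \<cdot> u) = shift_arr C t (zero_arr C A Y') \<longleftrightarrow> g' \<cdot> u = zero_arr C A Y'"
      using shift_uminus_arr[of _ "- t"] HomD(1) comp_Hom[OF u g'(1)] zero_Hom[OF obj(1) Y'(1)]
      by (metis minus_minus)
    ultimately have "g \<cdot> shift_arr C t u = zero_arr C (shift_obj C t A) Y \<longleftrightarrow>
        g' \<in> (\<lambda>h. h \<cdot> v) ` Hom C D Y'"
      using assms Y'(1) g'(1) by (simp add: coexact_def)
    also have "\<dots> \<longleftrightarrow> g \<in> (\<lambda>h. h \<cdot> shift_arr C t v) ` Hom C (shift_obj C t D) Y"
    proof
      assume "g' \<in> (\<lambda>h. h \<cdot> v) ` Hom C D Y'"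
      then obtain h where h: "h \<in> Hom C D Y'" "g' = h \<cdot> v" by blast
      then have "g = shift_arr C t h \<cdot> shift_arr C t v"
        using shift_comp[OF v h(1)] g'(2) by simp
      then show "g \<in> (\<lambda>h. h \<cdot> shift_arr C t v) ` Hom C (shift_obj C t D) Y"
        using shift_Hom[OF h(1), of t] Y'(2) by auto
    next
      assume "g \<in> (\<lambda>h. h \<cdot> shift_arr C t v) ` Hom C (shift_obj C t D) Y"
      then obtain h where h: "h \<in> Hom C (shift_obj C t D) Y" "g = h \<cdot> shift_arr C t v" by blast
      have "g' = shift_arr C (- t) h \<cdot> shift_arr C (- t) (shift_arr C t v)"
        unfolding g'_def h(2) using shift_comp[OF shift_Hom[OF v] h(1)] .
      then have "g' = shift_arr C (- t) h \<cdot> v"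
        using shift_uminus_arr[OF HomD(1)[OF v], of "- t"] by simp
      then show "g' \<in> (\<lambda>h. h \<cdot> v) ` Hom C D Y'"
        using unshift(1)[OF h(1) obj(4)] by blast
    qed
    finally show ?thesis .
  qed
  then show ?thesis
    unfolding coexact_def using shift_Hom u v by blast
qed

text \<open>
  Exactness at the three kinds of terms is exactness of \<open>Hom(-, Y)\<close> on a shift of the triangle
  \<open>P\<^sub>s \<rightarrow> X\<^sub>s \<rightarrow> X\<^sub>s\<^sub>+\<^sub>1 \<rightarrow> \<Sigma>P\<^sub>s\<close> at \<open>X\<^sub>s\<close>, at \<open>X\<^sub>s\<^sub>+\<^sub>1\<close> and at \<open>\<Sigma>P\<^sub>s\<close>. In the last two cases the shift is by
  \<open>t - 1\<close>, because there \<open>k\<close> lowers the internal degree.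
\<close>

lemma adams_couple_exact:
  assumes R: "adams_resolution C \<P> \<I> X R" and Y: "Y \<in> Obj C"
  shows "exact_couple (adams_couple C R Y)"
proof -
  let ?P = "res_proj R" and ?X = "res_obj R"
  have cover: "res_cover R s \<in> Hom C (?P s) (?X s)"
    and map: "res_map R s \<in> Hom C (?X s) (?X (Suc s))"
    and bd: "res_bd R s \<in> Hom C (?X (Suc s)) (susp_obj C (?P s))"
    and tri: "(res_cover R s, res_map R s, res_bd R s) \<in> Tri C" for s
    using R by (auto simp: adams_resolution_def)
  have objX: "?X s \<in> Obj C" and objP: "?P s \<in> Obj C" for s
    using Hom_Obj[OF cover[of s]] by auto
  have shift_susp: "shift_obj C (t - 1) (susp_obj C (?P s)) = shift_obj C t (?P s)" for s t
    using shift_susp_obj[OF objP] .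
  have bd': "shift_arr C (t - 1) (res_bd R s) \<in> Hom C (shift_obj C (t - 1) (?X (Suc s))) (shift_obj C t (?P s))"
    for s t
    using shift_Hom[OF bd, of "t - 1" s] by (simp add: shift_susp)
  have precomp: "(\<lambda>g. g \<cdot> f) \<in> hom (hom_group C B Y) (hom_group C A Y)" if "f \<in> Hom C A B" for f A B
    using group_hom.homh[OF precomp_group_hom[OF that Y]] .
  have at_X: "coexact (shift_obj C t (?P s)) (shift_obj C t (?X s)) (shift_obj C t (?X (Suc s)))
      (shift_arr C t (res_cover R s)) (shift_arr C t (res_map R s))" for s t
    using coexact_shift[OF triangle_coexact[OF tri cover map]] .
  have at_Suc: "coexact (shift_obj C (t - 1) (?X s)) (shift_obj C (t - 1) (?X (Suc s)))
      (shift_obj C t (?P s)) (shift_arr C (t - 1) (res_map R s)) (shift_arr C (t - 1) (res_bd R s))"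
    for s t
    using coexact_shift[OF triangle_coexact[OF rotate[OF tri] map bd], of "t - 1"]
    by (simp add: shift_susp)
  have at_P: "coexact (shift_obj C (t - 1) (?X (Suc s))) (shift_obj C t (?P s))
      (shift_obj C t (?X s)) (shift_arr C (t - 1) (res_bd R s)) (shift_arr C t (res_cover R s))"
    for s t
    using coexact_shift[OF triangle_coexact_susp[OF tri cover map], of "t - 1"]
    by (simp add: shift_susp shift_susp_obj[OF objX] shift_susp_arr[OF HomD(1)[OF cover]])
  show ?thesis
  proof (rule exact_couple.intro)
    fix s t
    show "comm_group (Dgrp (adams_couple C R Y) s t)" "comm_group (Egrp (adams_couple C R Y) s t)"
      using hom_comm_group shift_Obj objX objP Y by (simp_all add: adams_couple_def)
    show "imap (adams_couple C R Y) s t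
        \<in> hom (Dgrp (adams_couple C R Y) (Suc s) t) (Dgrp (adams_couple C R Y) s t)"
      using precomp[OF shift_Hom[OF map]] by (simp add: adams_couple_def)
    show "jmap (adams_couple C R Y) s t
        \<in> hom (Dgrp (adams_couple C R Y) s t) (Egrp (adams_couple C R Y) s t)"
      using precomp[OF shift_Hom[OF cover]] by (simp add: adams_couple_def)
    show "kmap (adams_couple C R Y) s t
        \<in> hom (Egrp (adams_couple C R Y) s t) (Dgrp (adams_couple C R Y) (Suc s) (t - 1))"
      using precomp[OF bd'] by (simp add: adams_couple_def)
  qed (use Y at_X at_Suc at_P in \<open>simp_all add: adams_couple_def coexact_def\<close>)
qed

end

section \<open>Projective classes and length\<close>

text \<open>
  Exponent \<open>0\<close> gives all arrows, not only the identities: in this way every power is closed under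
  precomposition, and the ghost lemma includes the case of length \<open>0\<close>.
\<close>

primrec ideal_power :: "('o, 'm, 'z) category_scheme \<Rightarrow> 'm set \<Rightarrow> nat \<Rightarrow> 'm set" where
  "ideal_power C \<I> 0 = Arr C"
| "ideal_power C \<I> (Suc n) = {g \<cdot>\<^bsub>C\<^esub> f | f g. f \<in> ideal_power C \<I> n \<and> g \<in> \<I> \<and> Cod C f = Dom C g}"

primrec res_comp :: "('o, 'm, 'z) category_scheme \<Rightarrow> ('o, 'm) resolution \<Rightarrow> nat \<Rightarrow> nat \<Rightarrow> 'm" where
  "res_comp C R s 0 = id_arr C (res_obj R s)"
| "res_comp C R s (Suc m) = res_map R (s + m) \<cdot>\<^bsub>C\<^esub> res_comp C R s m"

locale stable_projective_class = triangulated_category C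
  for C :: "('o, 'm, 'z) triangulated_scheme" (structure) +
  fixes \<P> :: "'o set" and \<I> :: "'m set"
  assumes proj_class: "projective_class C \<P> \<I>"
    and stable: "stable_class C \<P> \<I>"
begin

lemma P_Obj: "P \<in> \<P> \<Longrightarrow> P \<in> Obj C"
  using proj_class unfolding projective_class_def proj_objects_def by blast

lemma I_Arr: "f \<in> \<I> \<Longrightarrow> f \<in> Arr C"
  using proj_class unfolding projective_class_def null_maps_def by blast

lemma susp_P: "P \<in> \<P> \<Longrightarrow> susp_obj C P \<in> \<P>"
  and desusp_P: "P \<in> \<P> \<Longrightarrow> desusp_obj C P \<in> \<P>"
  and susp_I: "f \<in> \<I> \<Longrightarrow> susp_arr C f \<in> \<I>"
  using stable unfolding stable_class_def by auto

lemma I_comp_P: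
  assumes "f \<in> \<I>" "f \<in> Hom C X Y" "P \<in> \<P>" "h \<in> Hom C P X"
  shows "f \<cdot> h = zero_arr C P Y"
  using proj_class assms(1,3,4) HomD(2,3)[OF assms(2)]
  unfolding projective_class_def null_maps_def by blast

lemma null_mapI:
  assumes "f \<in> Hom C X Y" "\<And>P h. \<lbrakk>P \<in> \<P>; h \<in> Hom C P X\<rbrakk> \<Longrightarrow> f \<cdot> h = zero_arr C P Y"
  shows "f \<in> \<I>"
proof -
  have "f \<in> null_maps C \<P>"
    using assms HomD[OF assms(1)] by (simp add: null_maps_def)
  then show ?thesis
    using proj_class by (simp add: projective_class_def)
qed

lemma projectiveI:
  assumes "P \<in> Obj C"
    "\<And>f h X Y. \<lbrakk>f \<in> \<I>; f \<in> Hom C X Y; h \<in> Hom C P X\<rbrakk> \<Longrightarrow> f \<cdot> h = zero_arr C P Y"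
  shows "P \<in> \<P>"
proof -
  have "P \<in> proj_objects C \<I>"
    using assms(1) assms(2)[OF _ HomI[OF I_Arr]] by (simp add: proj_objects_def)
  then show ?thesis
    using proj_class by (simp add: projective_class_def)
qed

lemma I_postcomp:
  assumes f: "f \<in> \<I>" "f \<in> Hom C X Y" and g: "g \<in> Hom C Y Z"
  shows "g \<cdot> f \<in> \<I>"
proof (rule null_mapI[OF comp_Hom[OF f(2) g]])
  fix P h assume P: "P \<in> \<P>" and h: "h \<in> Hom C P X"
  show "(g \<cdot> f) \<cdot> h = zero_arr C P Z"
    using comp_assoc[OF h f(2) g] I_comp_P[OF f P h] comp_zero[OF g P_Obj[OF P]] by simp
qed

lemma zero_in_I:
  assumes "X \<in> Obj C" "Y \<in> Obj C"
  shows "zero_arr C X Y \<in> \<I>"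
  by (rule null_mapI[OF zero_Hom[OF assms]]) (simp add: zero_comp assms)

lemma zero_object_in_P: "zero_object C Z \<Longrightarrow> Z \<in> \<P>"
  using Hom_from_zero comp_Hom by (intro projectiveI) (auto simp: zero_object_def)

lemma P_retract:
  assumes V: "V \<in> \<P>" and X: "retract_of C X V"
  shows "X \<in> \<P>"
proof -
  obtain s r where s: "s \<in> Hom C X V" and r: "r \<in> Hom C V X" and rs: "r \<cdot> s = id_arr C X"
    using X by (auto simp: retract_of_def)
  show ?thesis
  proof (rule projectiveI)
    show "X \<in> Obj C" using Hom_Obj[OF s] by simp
    fix f h A B assume f: "f \<in> \<I>" "f \<in> Hom C A B" and h: "h \<in> Hom C X A"
    have hr: "h \<cdot> r \<in> Hom C V A"
      using comp_Hom[OF r h] .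
    have "f \<cdot> h = f \<cdot> ((h \<cdot> r) \<cdot> s)"
      using comp_assoc[OF s r h] rs id_right[OF h] by simp
    also have "\<dots> = (f \<cdot> (h \<cdot> r)) \<cdot> s"
      using comp_assoc[OF s hr f(2)] .
    also have "f \<cdot> (h \<cdot> r) = zero_arr C V B"
      using I_comp_P[OF f V hr] .
    also have "zero_arr C V B \<cdot> s = zero_arr C X B"
      using zero_comp[OF s] Hom_Obj[OF f(2)] by simp
    finally show "f \<cdot> h = zero_arr C X B" .
  qed
qed

lemma retract_trans:
  assumes "retract_of C X Y" "retract_of C Y Z"
  shows "retract_of C X Z"
proof -
  obtain s r where s: "s \<in> Hom C X Y" and r: "r \<in> Hom C Y X" and rs: "r \<cdot> s = id_arr C X"
    using assms(1) by (auto simp: retract_of_def)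
  obtain s' r' where s': "s' \<in> Hom C Y Z" and r': "r' \<in> Hom C Z Y" and rs': "r' \<cdot> s' = id_arr C Y"
    using assms(2) by (auto simp: retract_of_def)
  have "(r \<cdot> r') \<cdot> (s' \<cdot> s) = r \<cdot> ((r' \<cdot> s') \<cdot> s)"
    using comp_assoc[OF comp_Hom[OF s s'] r' r] comp_assoc[OF s s' r'] by simp
  also have "\<dots> = id_arr C X"
    using rs rs' id_left[OF s] by simp
  finally show ?thesis
    using comp_Hom[OF s s'] comp_Hom[OF r' r] by (auto simp: retract_of_def)
qed

lemma retract_refl: "X \<in> Obj C \<Longrightarrow> retract_of C X X"
  using id_Hom[of X] id_left[OF id_Hom[of X]] by (auto simp: retract_of_def)

lemma length_class_SucI:
  assumes "(u, v, w) \<in> Tri C" "u \<in> Hom C A B" "v \<in> Hom C B D"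
    and "A \<in> length_class C \<P> n" "0 < n" "D \<in> \<P>" "retract_of C X B"
  shows "X \<in> length_class C \<P> (Suc n)"
proof -
  obtain k where n: "n = Suc k"
    using assms(5) by (cases n) auto
  have "X \<in> Obj C"
    using assms(7) Hom_Obj by (auto simp: retract_of_def)
  then show ?thesis
    unfolding n using assms(1,4,6,7) HomD(2,3)[OF assms(2)] HomD(3)[OF assms(3)] n
    by (simp only: length_class.simps mem_Collect_eq) metis
qed

lemma length_class_SucE:
  assumes "X \<in> length_class C \<P> (Suc n)" "0 < n"
  obtains u v w A B D where "(u, v, w) \<in> Tri C" "u \<in> Hom C A B" "v \<in> Hom C B D"
    "A \<in> length_class C \<P> n" "D \<in> \<P>" "retract_of C X B"
proof -
  obtain k where n: "n = Suc k"
    using assms(2) by (cases n) auto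
  from assms(1) obtain u v w where uvw: "(u, v, w) \<in> Tri C" "Dom C u \<in> length_class C \<P> n"
      "Cod C v \<in> \<P>" "retract_of C X (Cod C u)"
    unfolding n by auto
  moreover obtain A B D where "u \<in> Hom C A B" "v \<in> Hom C B D"
    using triangleE[OF uvw(1)] by metis
  ultimately show thesis
    using that by (auto simp: Hom_def)
qed

lemma length_class_retract:
  assumes "V \<in> length_class C \<P> n" "0 < n" "retract_of C X V"
  shows "X \<in> length_class C \<P> n"
proof -
  obtain m where n: "n = Suc m"
    using assms(2) by (cases n) auto
  show ?thesis
  proof (cases "m = 0")
    case True
    then show ?thesis
      using assms(1,3) P_retract n by simp
  next
    case False
    then obtain u v w A B D where "(u, v, w) \<in> Tri C" "u \<in> Hom C A B" "v \<in> Hom C B D"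
        "A \<in> length_class C \<P> m" "D \<in> \<P>" "retract_of C V B"
      using length_class_SucE[of V m] assms(1) n by blast
    then show ?thesis
      unfolding n using length_class_SucI False retract_trans[OF assms(3)] by blast
  qed
qed

lemma desusp_length_class:
  assumes "0 < n" "X \<in> length_class C \<P> n"
  shows "desusp_obj C X \<in> length_class C \<P> n"
  using assms
proof (induction n arbitrary: X)
  case (Suc n)
  show ?case
  proof (cases n)
    case 0
    then show ?thesis using Suc.prems desusp_P by simp
  next
    case (Suc k)
    then obtain u v w A B D where tri: "(u, v, w) \<in> Tri C"
      and u: "u \<in> Hom C A B" and v: "v \<in> Hom C B D"
      and A: "A \<in> length_class C \<P> n" and D: "D \<in> \<P>" and ret: "retract_of C X B"
      using length_class_SucE[OF Suc.prems(2)] by blast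
    obtain s r where s: "s \<in> Hom C X B" and r: "r \<in> Hom C B X" and rs: "r \<cdot> s = id_arr C X"
      using ret by (auto simp: retract_of_def)
    have "desusp_arr C r \<cdot> desusp_arr C s = id_arr C (desusp_obj C X)"
      using desusp_comp[OF s r] rs desusp_id Hom_Obj[OF s] by simp
    then have "retract_of C (desusp_obj C X) (desusp_obj C B)"
      using desusp_Hom[OF s] desusp_Hom[OF r] by (auto simp: retract_of_def)
    moreover have "desusp_obj C A \<in> length_class C \<P> n"
      using Suc.IH A \<open>n = Suc k\<close> by simp
    ultimately show ?thesis
      using length_class_SucI[OF desusp_triangle[OF tri u v] neg_Hom[OF desusp_Hom[OF u]]
          neg_Hom[OF desusp_Hom[OF v]] _ _ desusp_P[OF D]] \<open>n = Suc k\<close> by blast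
  qed
qed simp

lemma ideal_power_Arr: "f \<in> ideal_power C \<I> n \<Longrightarrow> f \<in> Arr C"
proof (induction n arbitrary: f)
  case (Suc n)
  then obtain f' g where "f = g \<cdot> f'" "f' \<in> ideal_power C \<I> n" "g \<in> \<I>" "Cod C f' = Dom C g"
    unfolding ideal_power.simps by blast
  then have f: "f = g \<cdot> f'" and f': "f' \<in> Hom C (Dom C f') (Dom C g)"
      and g: "g \<in> Hom C (Dom C g) (Cod C g)"
    using HomI[OF Suc.IH, of f'] HomI[OF I_Arr, of g] by simp_all
  show ?case
    unfolding f using HomD(1)[OF comp_Hom[OF f' g]] .
qed simp

lemma ideal_power_SucE:
  assumes "f \<in> ideal_power C \<I> (Suc n)" "f \<in> Hom C X Y"
  obtains f' g Z where "f' \<in> ideal_power C \<I> n" "f' \<in> Hom C X Z" "g \<in> \<I>" "g \<in> Hom C Z Y" "f = g \<cdot> f'"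
proof -
  obtain f' g where f: "f = g \<cdot> f'" "f' \<in> ideal_power C \<I> n" "g \<in> \<I>" "Cod C f' = Dom C g"
    using assms(1) by auto
  then have f': "f' \<in> Hom C (Dom C f') (Dom C g)" and g: "g \<in> Hom C (Dom C g) (Cod C g)"
    using HomI[OF ideal_power_Arr, of f'] HomI[OF I_Arr, of g] by simp_all
  have "Dom C f' = X" "Cod C g = Y"
    using HomD(2,3)[OF comp_Hom[OF f' g]] HomD(2,3)[OF assms(2)] f(1) by simp_all
  then show thesis
    using that[OF f(2) _ f(3) _ f(1)] f' g by simp
qed

lemma ideal_power_precomp:
  assumes "f \<in> ideal_power C \<I> n" "f \<in> Hom C X Y" "h \<in> Hom C W X"
  shows "f \<cdot> h \<in> ideal_power C \<I> n"
  using assms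
proof (induction n arbitrary: f Y)
  case 0
  then show ?case using HomD(1)[OF comp_Hom[OF assms(3) 0(2)]] by simp
next
  case (Suc n)
  obtain f' g Z where f: "f' \<in> ideal_power C \<I> n" "f' \<in> Hom C X Z" "g \<in> \<I>" "g \<in> Hom C Z Y" "f = g \<cdot> f'"
    using ideal_power_SucE[OF Suc.prems(1,2)] .
  have "f' \<cdot> h \<in> ideal_power C \<I> n"
    using Suc.IH f Suc.prems by blast
  moreover have "f \<cdot> h = g \<cdot> (f' \<cdot> h)"
    using comp_assoc[OF Suc.prems(3) f(2,4)] f(5) by simp
  moreover have "Cod C (f' \<cdot> h) = Dom C g"
    using comp_Hom[OF Suc.prems(3) f(2)] f(4) by (simp add: Hom_def)
  ultimately show ?case
    using f(3) by auto
qed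

text \<open>
  Let \<open>X\<close> be a retract of \<open>V\<close> in a triangle \<open>A \<rightarrow> V \<rightarrow> D\<close> with \<open>A\<close> of length \<open>n\<close> and \<open>D\<close> in \<open>\<P>\<close>.
  The composite of the first \<open>n\<close> of \<open>n + 1\<close> maps in \<open>\<I>\<close> out of \<open>V\<close> vanishes on \<open>A\<close>, hence factors
  through \<open>D\<close>, and there the last map kills it.
\<close>

lemma ghost_lemma:
  assumes "X \<in> length_class C \<P> n" "f \<in> ideal_power C \<I> n" "f \<in> Hom C X Y"
  shows "f = zero_arr C X Y"
  using assms
proof (induction n arbitrary: X f Y)
  case 0
  then show ?case using Hom_from_zero by simp
next
  case (Suc n)
  show ?case
  proof (cases n)
    case 0
    obtain f' g Z where f: "f' \<in> Hom C X Z" "g \<in> \<I>" "g \<in> Hom C Z Y" "f = g \<cdot> f'"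
      using ideal_power_SucE[OF Suc.prems(2,3)] .
    then show ?thesis
      using I_comp_P[OF f(2,3) _ f(1)] Suc.prems(1) 0 by simp
  next
    case (Suc k)
    then obtain u v w A V D where tri: "(u, v, w) \<in> Tri C"
      and u: "u \<in> Hom C A V" and v: "v \<in> Hom C V D"
      and A: "A \<in> length_class C \<P> n" and D: "D \<in> \<P>" and ret: "retract_of C X V"
      using length_class_SucE[OF Suc.prems(1)] by blast
    obtain s r where s: "s \<in> Hom C X V" and r: "r \<in> Hom C V X" and rs: "r \<cdot> s = id_arr C X"
      using ret by (auto simp: retract_of_def)
    have fr: "f \<cdot> r \<in> ideal_power C \<I> (Suc n)" "f \<cdot> r \<in> Hom C V Y"
      using ideal_power_precomp[OF Suc.prems(2,3) r] comp_Hom[OF r Suc.prems(3)] .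
    obtain f' g Z where f': "f' \<in> ideal_power C \<I> n" "f' \<in> Hom C V Z"
      and g: "g \<in> \<I>" "g \<in> Hom C Z Y" and eq: "f \<cdot> r = g \<cdot> f'"
      using ideal_power_SucE[OF fr] .
    have "f' \<cdot> u = zero_arr C A Z"
      using Suc.IH[OF _ ideal_power_precomp[OF f' u] comp_Hom[OF u f'(2)]] A by simp
    then obtain h where h: "h \<in> Hom C D Z" "f' = h \<cdot> v"
      using weak_cokernel[OF tri u v f'(2)] by blast
    have "g \<cdot> h = zero_arr C D Y"
      using I_comp_P[OF g D h(1)] .
    then have "f \<cdot> r = zero_arr C V Y"
      using comp_assoc[OF v h(1) g(2)] eq h(2) zero_comp[OF v] Hom_Obj[OF g(2)] by simp
    then have "f \<cdot> (r \<cdot> s) = zero_arr C X Y"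
      using comp_assoc[OF s r Suc.prems(3)] zero_comp[OF s] Hom_Obj[OF g(2)] by simp
    then show ?thesis
      using rs id_right[OF Suc.prems(3)] by simp
  qed
qed

end

section \<open>Adams resolutions of objects of finite length\<close>

context stable_projective_class
begin

lemma resolution_triangle:
  assumes "adams_resolution C \<P> \<I> X R"
  shows "res_obj R 0 = X" "res_proj R s \<in> \<P>"
    and "res_cover R s \<in> Hom C (res_proj R s) (res_obj R s)"
    and "res_map R s \<in> Hom C (res_obj R s) (res_obj R (Suc s))"
    and "res_bd R s \<in> Hom C (res_obj R (Suc s)) (susp_obj C (res_proj R s))"
    and "res_map R s \<in> \<I>"
    and "(res_cover R s, res_map R s, res_bd R s) \<in> Tri C"
  using assms by (auto simp: adams_resolution_def)

text \<open>
  Choose a cofibre sequence \<open>P \<rightarrow> X \<rightarrow> Y\<close> for every object and iterate \<open>X \<mapsto> Y\<close>.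
\<close>

lemma ex_adams_resolution:
  assumes X: "X \<in> Obj C"
  shows "\<exists>R. adams_resolution C \<P> \<I> X R"
proof -
  have "\<forall>X \<in> Obj C. \<exists>u v w. (u, v, w) \<in> Tri C \<and> Dom C u \<in> \<P> \<and> Cod C u = X \<and> v \<in> \<I>"
    using proj_class by (simp add: projective_class_def)
  then obtain u v w where uvw: "\<And>X. X \<in> Obj C \<Longrightarrow>
      (u X, v X, w X) \<in> Tri C \<and> Dom C (u X) \<in> \<P> \<and> Cod C (u X) = X \<and> v X \<in> \<I>"
    by metis
  define x where "x = rec_nat X (\<lambda>_ A. Cod C (v A))"
  have x_0: "x 0 = X" and x_Suc: "x (Suc s) = Cod C (v (x s))" for s
    by (simp_all add: x_def)
  have x_Obj: "x s \<in> Obj C" for s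
    by (induction s) (use X uvw I_Arr Cod_Obj in \<open>auto simp: x_0 x_Suc\<close>)
  define R where "R = \<lparr>res_obj = x, res_proj = (\<lambda>s. Dom C (u (x s))), res_cover = (\<lambda>s. u (x s)),
    res_map = (\<lambda>s. v (x s)), res_bd = (\<lambda>s. w (x s))\<rparr>"
  have "adams_resolution C \<P> \<I> X R"
    unfolding adams_resolution_def
  proof (intro conjI allI)
    fix s
    note t = uvw[OF x_Obj[of s]]
    have "candidate_triangle C (u (x s)) (v (x s)) (w (x s))"
      using t Tri_candidate by blast
    then show "res_cover R s \<in> Hom C (res_proj R s) (res_obj R s)"
      "res_map R s \<in> Hom C (res_obj R s) (res_obj R (Suc s))"
      "res_bd R s \<in> Hom C (res_obj R (Suc s)) (susp_obj C (res_proj R s))"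
      using t by (auto simp: R_def x_Suc candidate_triangle_def Hom_def)
  qed (use uvw[OF x_Obj] in \<open>simp_all add: R_def x_0\<close>)
  then show ?thesis by blast
qed

text \<open>
  An arbitrary resolution of a zero object can have nonzero terms \<open>P\<^sub>s\<close>, so that its first page need not
  vanish. The statement for length \<open>0\<close> is about the constant resolution.
\<close>

lemma zero_object_resolution:
  assumes "zero_object C X"
  shows "\<exists>R. adams_resolution C \<P> \<I> X R \<and> (\<forall>s. res_obj R s = X)"
proof -
  have X: "X \<in> Obj C"
    using assms by (simp add: zero_object_def)
  define R where "R = \<lparr>res_obj = (\<lambda>_. X), res_proj = (\<lambda>_. X), res_cover = (\<lambda>_::nat. id_arr C X),
    res_map = (\<lambda>_. zero_arr C X X), res_bd = (\<lambda>_. zero_arr C X (susp_obj C X))\<rparr>"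
  have "adams_resolution C \<P> \<I> X R"
    using zero_object_in_P[OF assms] id_Hom[OF X] zero_Hom X susp_Obj[OF X] zero_in_I
      TR1_id[OF X assms]
    by (simp add: adams_resolution_def R_def)
  moreover have "\<forall>s. res_obj R s = X"
    by (simp add: R_def)
  ultimately show ?thesis by blast
qed

lemma res_comp_Hom:
  assumes "adams_resolution C \<P> \<I> X R"
  shows "res_comp C R s m \<in> Hom C (res_obj R s) (res_obj R (s + m))"
proof (induction m)
  case 0
  show ?case
    using id_Hom Hom_Obj[OF resolution_triangle(4)[OF assms, of s]] by simp
next
  case (Suc m)
  then show ?case
    using comp_Hom[OF Suc resolution_triangle(4)[OF assms]] by simp
qed

lemma res_comp_ideal_power:
  assumes "adams_resolution C \<P> \<I> X R"
  shows "res_comp C R s m \<in> ideal_power C \<I> m"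
proof (induction m)
  case 0
  show ?case
    using HomD(1)[OF res_comp_Hom[OF assms, of s 0]] by simp
next
  case (Suc m)
  have "Cod C (res_comp C R s m) = Dom C (res_map R (s + m))"
    using HomD(3)[OF res_comp_Hom[OF assms, of s m]]
      HomD(2)[OF resolution_triangle(4)[OF assms, of "s + m"]] by simp
  then show ?case
    unfolding ideal_power.simps res_comp.simps using Suc resolution_triangle(6)[OF assms] by blast
qed

lemma res_comp_Suc_left:
  assumes R: "adams_resolution C \<P> \<I> X R"
  shows "res_comp C R s (Suc m) = res_comp C R (Suc s) m \<cdot> res_map R s"
proof (induction m)
  case 0
  show ?case
    using resolution_triangle(4)[OF R, of s] id_left id_right by simp
next
  case (Suc m)
  have "res_comp C R s (Suc (Suc m)) = res_map R (Suc s + m) \<cdot> (res_comp C R (Suc s) m \<cdot> res_map R s)"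
    using Suc by simp
  also have "\<dots> = (res_map R (Suc s + m) \<cdot> res_comp C R (Suc s) m) \<cdot> res_map R s"
    using comp_assoc[OF resolution_triangle(4)[OF R] res_comp_Hom[OF R] resolution_triangle(4)[OF R]] .
  finally show ?case by simp
qed

lemma iter_i_adams_couple:
  assumes R: "adams_resolution C \<P> \<I> X R"
    and g: "g \<in> Hom C (shift_obj C t (res_obj R (s + r))) Y"
  shows "iter_i (adams_couple C R Y) r s t g = g \<cdot> shift_arr C t (res_comp C R s r)"
  using g
proof (induction r arbitrary: g)
  case 0
  then show ?case
    using shift_id id_right Hom_Obj[OF res_comp_Hom[OF R, of s 0]] by simp
next
  case (Suc r)
  have map: "res_map R (s + r) \<in> Hom C (res_obj R (s + r)) (res_obj R (s + Suc r))"
    using resolution_triangle(4)[OF R] by simp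
  have "iter_i (adams_couple C R Y) (Suc r) s t g =
      iter_i (adams_couple C R Y) r s t (g \<cdot> shift_arr C t (res_map R (s + r)))"
    by (simp add: adams_couple_def)
  also have "\<dots> = (g \<cdot> shift_arr C t (res_map R (s + r))) \<cdot> shift_arr C t (res_comp C R s r)"
    using Suc.IH comp_Hom[OF shift_Hom[OF map] Suc.prems] .
  also have "\<dots> = g \<cdot> (shift_arr C t (res_map R (s + r)) \<cdot> shift_arr C t (res_comp C R s r))"
    using comp_assoc[OF shift_Hom[OF res_comp_Hom[OF R]] shift_Hom[OF map] Suc.prems] by simp
  also have "\<dots> = g \<cdot> shift_arr C t (res_comp C R s (Suc r))"
    using shift_comp[OF res_comp_Hom[OF R] map] by simp
  finally show ?case .
qed

text \<open>
  If \<open>X\<^sub>s \<rightarrow> X\<^sub>s\<^sub>+\<^sub>n\<close> vanishes, then \<open>X\<^sub>s\<^sub>+\<^sub>1 \<rightarrow> X\<^sub>s\<^sub>+\<^sub>n\<close> factors through \<open>X\<^sub>s\<^sub>+\<^sub>1 \<rightarrow> \<Sigma>P\<^sub>s\<close>, and composing with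
  the next map, which is in \<open>\<I>\<close>, kills it because \<open>\<Sigma>P\<^sub>s\<close> is in \<open>\<P>\<close>. So the vanishing propagates from
  \<open>X\<close> to all terms of the resolution. The argument
  needs at least one map to compose with, hence \<open>0 < n\<close>.
\<close>

lemma res_comp_zero_everywhere:
  assumes R: "adams_resolution C \<P> \<I> X R" and "0 < n"
    and zero: "res_comp C R 0 n = zero_arr C X (res_obj R n)"
  shows "res_comp C R s n = zero_arr C (res_obj R s) (res_obj R (s + n))"
proof (induction s)
  case 0
  then show ?case
    using zero resolution_triangle(1)[OF R] by simp
next
  case (Suc s)
  obtain m where n: "n = Suc m"
    using \<open>0 < n\<close> by (cases n) auto
  note tri = resolution_triangle[OF R]
  have obj: "res_obj R k \<in> Obj C" for k
    using Hom_Obj[OF tri(4)] by blast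
  have "res_comp C R (Suc s) m \<cdot> res_map R s = zero_arr C (res_obj R s) (res_obj R (Suc s + m))"
    using Suc res_comp_Suc_left[OF R] n by simp
  then obtain h where h: "h \<in> Hom C (susp_obj C (res_proj R s)) (res_obj R (Suc s + m))"
      "res_comp C R (Suc s) m = h \<cdot> res_bd R s"
    using weak_cokernel[OF rotate[OF tri(7)] tri(4,5) res_comp_Hom[OF R]] by blast
  have "res_comp C R (Suc s) n = (res_map R (Suc s + m) \<cdot> h) \<cdot> res_bd R s"
    using h(2) n comp_assoc[OF tri(5) h(1) tri(4)] by simp
  also have "res_map R (Suc s + m) \<cdot> h = zero_arr C (susp_obj C (res_proj R s)) (res_obj R (Suc s + n))"
    using I_comp_P[OF tri(6) tri(4) susp_P[OF tri(2)] h(1)] n by simp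
  finally show ?case
    using zero_comp[OF tri(5) obj] by simp
qed

lemma iter_i_trivial:
  assumes R: "adams_resolution C \<P> \<I> X R" and Y: "Y \<in> Obj C"
    and zero: "res_comp C R s n = zero_arr C (res_obj R s) (res_obj R (s + n))"
    and y: "y \<in> carrier (Dgrp (adams_couple C R Y) (s + n) t)"
  shows "iter_i (adams_couple C R Y) n s t y = \<one>\<^bsub>Dgrp (adams_couple C R Y) s t\<^esub>"
proof -
  have obj: "res_obj R k \<in> Obj C" for k
    using Hom_Obj[OF resolution_triangle(4)[OF R]] by blast
  have y': "y \<in> Hom C (shift_obj C t (res_obj R (s + n))) Y"
    using y by (simp add: adams_couple_def)
  show ?thesis
    using iter_i_adams_couple[OF R y'] zero shift_zero[OF obj obj] comp_zero[OF y' shift_Obj[OF obj]]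
    by (simp add: adams_couple_def)
qed

lemma collapses_in_rows_if_res_comp_zero:
  assumes R: "adams_resolution C \<P> \<I> X R" and Y: "Y \<in> Obj C"
    and zero: "\<And>s. res_comp C R s n = zero_arr C (res_obj R s) (res_obj R (s + n))"
  shows "collapses_in_rows C R Y n" "converges_strongly (adams_couple C R Y)"
proof -
  interpret exact_couple "adams_couple C R Y"
    using adams_couple_exact[OF R Y] .
  note trivial = iter_i_trivial[OF R Y zero]
  show "collapses_in_rows C R Y n"
    unfolding collapses_in_rows_def
    using collapses_if_trivial[OF trivial] page_eq_page_inf_if_trivial[OF trivial]
      concentrated_if_trivial[OF trivial] by blast
  show "converges_strongly (adams_couple C R Y)"
    using converges_strongly_if_trivial[OF trivial] .
qed

lemma res_comp_zero_if_length:
  assumes R: "adams_resolution C \<P> \<I> X R" and X: "X \<in> length_class C \<P> n" and "0 < n"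
  shows "res_comp C R s n = zero_arr C (res_obj R s) (res_obj R (s + n))"
proof (rule res_comp_zero_everywhere[OF R \<open>0 < n\<close>])
  show "res_comp C R 0 n = zero_arr C X (res_obj R n)"
    using ghost_lemma[OF X res_comp_ideal_power[OF R]] res_comp_Hom[OF R, of 0 n]
      resolution_triangle(1)[OF R] by simp
qed

text \<open>
  Strong convergence for length \<open>0\<close> is reduced to length \<open>1\<close>, where vanishing holds for every
  resolution.
\<close>

lemma length_class_positive:
  assumes "X \<in> length_class C \<P> n"
  shows "\<exists>m > 0. X \<in> length_class C \<P> m"
proof (cases n)
  case 0
  then have "X \<in> length_class C \<P> 1"
    using assms zero_object_in_P by simp
  then show ?thesis by blast
qed (use assms in blast)

text \<open>
  The octahedral axiom for \<open>X \<rightarrow> X\<^sub>n \<rightarrow> X\<^sub>n\<^sub>+\<^sub>1\<close> gives a triangle \<open>C\<^sub>n \<rightarrow> C\<^sub>n\<^sub>+\<^sub>1 \<rightarrow> \<Sigma>P\<^sub>n\<close> of cones, where \<open>C\<^sub>n\<close> is the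
  cone of \<open>X \<rightarrow> X\<^sub>n\<close>. It starts with \<open>C\<^sub>1 = \<Sigma>P\<^sub>0\<close>.
\<close>

lemma res_comp_cone_length:
  assumes R: "adams_resolution C \<P> \<I> X R" and "0 < n"
  shows "\<exists>p q. (res_comp C R 0 n, p, q) \<in> Tri C \<and> Cod C p \<in> length_class C \<P> n"
  using \<open>0 < n\<close>
proof (induction n)
  case (Suc n)
  note tri = resolution_triangle[OF R]
  show ?case
  proof (cases "n = 0")
    case True
    then have "res_comp C R 0 (Suc n) = res_map R 0"
      using id_right[OF tri(4)] by simp
    then show ?thesis
      using rotate[OF tri(7), of 0] susp_P[OF tri(2)] HomD(3)[OF tri(5)] True by auto
  next
    case False
    then obtain j k where jk: "(res_comp C R 0 n, j, k) \<in> Tri C" "Cod C j \<in> length_class C \<P> n"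
      using Suc.IH by auto
    have comp: "res_comp C R 0 (Suc n) = res_map R n \<cdot> res_comp C R 0 n"
      by simp
    obtain p q where pq: "(res_map R n \<cdot> res_comp C R 0 n, p, q) \<in> Tri C"
      using TR1_cone HomD(1)[OF res_comp_Hom[OF R, of 0 "Suc n"]] unfolding comp by blast
    have "Cod C (res_comp C R 0 n) = Dom C (res_map R n)"
      using HomD(3)[OF res_comp_Hom[OF R, of 0 n]] HomD(2)[OF tri(4)] by simp
    then obtain f g where fg: "(f, g, susp_arr C j \<cdot> neg_arr C (susp_arr C (res_cover R n))) \<in> Tri C"
        "f \<in> Hom C (Cod C j) (Cod C p)" "g \<in> Hom C (Cod C p) (Cod C (res_bd R n))"
      using TR4[OF _ jk(1) rotate[OF tri(7)] pq] by blast
    have "Cod C (res_bd R n) \<in> \<P>"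
      using HomD(3)[OF tri(5)] susp_P[OF tri(2)] by simp
    then have "Cod C p \<in> length_class C \<P> (Suc n)"
      using length_class_SucI[OF fg jk(2)] False retract_refl Hom_Obj[OF fg(3)] by simp
    then show ?thesis
      using pq comp by auto
  qed
qed simp

text \<open>
  If \<open>X \<rightarrow> X\<^sub>n\<close> is zero, the identity of \<open>\<Sigma>X\<close> lifts through \<open>C\<^sub>n \<rightarrow> \<Sigma>X\<close>, so \<open>\<Sigma>X\<close> is a retract of the
  cone \<open>C\<^sub>n\<close>, which has length at most \<open>n\<close>.
\<close>

lemma length_if_res_comp_zero:
  assumes R: "adams_resolution C \<P> \<I> X R" and X: "X \<in> Obj C"
    and zero: "res_comp C R 0 n = zero_arr C X (res_obj R n)"
  shows "X \<in> length_class C \<P> n"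
proof (cases "n = 0")
  case True
  then have "id_arr C X = zero_arr C X X"
    using zero resolution_triangle(1)[OF R] by simp
  then show ?thesis
    using True zero_objectI[OF X] by simp
next
  case False
  then have "0 < n" by simp
  obtain p q where pq: "(res_comp C R 0 n, p, q) \<in> Tri C" "Cod C p \<in> length_class C \<P> n"
    using res_comp_cone_length[OF R \<open>0 < n\<close>] by blast
  have u: "res_comp C R 0 n \<in> Hom C X (res_obj R n)"
    using res_comp_Hom[OF R, of 0 n] resolution_triangle(1)[OF R] by simp
  obtain D where p: "p \<in> Hom C (res_obj R n) D" and q: "q \<in> Hom C D (susp_obj C X)"
    using triangleE[OF pq(1)] u HomD(2,3) by metis
  let ?SX = "susp_obj C X"
  have SX: "?SX \<in> Obj C" "susp_obj C (res_obj R n) \<in> Obj C"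
    using susp_Obj X Hom_Obj[OF u] by auto
  have "neg_arr C (susp_arr C (res_comp C R 0 n)) = zero_arr C ?SX (susp_obj C (res_obj R n))"
    using zero susp_zero neg_zero SX X Hom_Obj[OF u] by simp
  then have "neg_arr C (susp_arr C (res_comp C R 0 n)) \<cdot> id_arr C ?SX =
      zero_arr C ?SX (susp_obj C (res_obj R n))"
    using zero_comp[OF id_Hom[OF SX(1)] SX(2)] by simp
  then obtain s where "s \<in> Hom C ?SX D" "id_arr C ?SX = q \<cdot> s"
    using weak_kernel[OF rotate[OF rotate[OF pq(1)]] q neg_Hom[OF susp_Hom[OF u]] id_Hom[OF SX(1)]]
    by blast
  then have "retract_of C ?SX D"
    using q by (auto simp: retract_of_def)
  then have "?SX \<in> length_class C \<P> n"
    using length_class_retract[OF pq(2) \<open>0 < n\<close>] HomD(3)[OF p] by simp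
  then show ?thesis
    using desusp_length_class[OF \<open>0 < n\<close>] desusp_susp_obj[OF X] by metis
qed

end

section \<open>The telescope of a sequence of maps in the ideal\<close>

lemma coproduct_ex1:
  assumes "is_coproduct C J A Q \<iota>" "T \<in> Obj C" "\<And>i. i \<in> J \<Longrightarrow> g i \<in> Hom C (A i) T"
  shows "\<exists>!h. h \<in> Hom C Q T \<and> (\<forall>i \<in> J. h \<cdot>\<^bsub>C\<^esub> \<iota> i = g i)"
proof -
  have "\<forall>T \<in> Obj C. \<forall>g. (\<forall>i \<in> J. g i \<in> Hom C (A i) T) \<longrightarrow>
      (\<exists>!h. h \<in> Hom C Q T \<and> (\<forall>i \<in> J. h \<cdot>\<^bsub>C\<^esub> \<iota> i = g i))"
    using assms(1) unfolding is_coproduct_def by (elim conjE)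
  from this[rule_format, of T g] show ?thesis
    using assms(2,3) by simp
qed

lemma (in category) coproduct_eqI:
  assumes Q: "is_coproduct C J A Q \<iota>" and h: "h \<in> Hom C Q T" "h' \<in> Hom C Q T"
    and eq: "\<And>i. i \<in> J \<Longrightarrow> h \<cdot> \<iota> i = h' \<cdot> \<iota> i"
  shows "h = h'"
proof -
  have "\<iota> i \<in> Hom C (A i) Q" if "i \<in> J" for i
    using Q that by (simp add: is_coproduct_def)
  then have "\<exists>!k. k \<in> Hom C Q T \<and> (\<forall>i \<in> J. k \<cdot> \<iota> i = h' \<cdot> \<iota> i)"
    using comp_Hom h(2) Hom_Obj(2)[OF h(1)] by (intro coproduct_ex1[OF Q]) blast+
  then show ?thesis
    by (rule ex1E) (metis eq h)
qed

context stable_projective_class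
begin

lemma zero_object_if_no_maps_from_P:
  assumes "generates C \<P>" "T \<in> Obj C"
    and "\<And>P h. \<lbrakk>P \<in> \<P>; h \<in> Hom C P T\<rbrakk> \<Longrightarrow> h = zero_arr C P T"
  shows "zero_object C T"
proof (rule ccontr)
  assume "\<not> zero_object C T"
  then obtain P where P: "P \<in> \<P>" "Hom C P T \<noteq> {zero_arr C P T}"
    using assms(1,2) unfolding generates_def by blast
  moreover have "Hom C P T = {zero_arr C P T}"
    using assms(3)[OF P(1)] zero_Hom[OF P_Obj[OF P(1)] assms(2)] by blast
  ultimately show False by simp
qed

text \<open>
  Let \<open>\<sigma>\<close> be the endomorphism of \<open>Q = \<Coprod>x\<^sub>s\<close> induced by the \<open>f\<^sub>s\<close>. The closure of \<open>\<I>\<close> under countable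
  coproducts puts it into \<open>\<I>\<close>, so \<open>\<theta> = 1 - \<sigma>\<close> and its suspension act as the identity on maps from
  objects of \<open>\<P>\<close>. Hence there are no nonzero maps from \<open>\<P>\<close> to the cone of \<open>\<theta>\<close>, the telescope, and
  the telescope is zero. A compatible family is a map out of \<open>Q\<close> that kills \<open>\<theta>\<close>, so it factors
  through the telescope.
\<close>

lemma compatible_maps_vanish:
  assumes gen: "generates C \<P>" and closed: "closed_under_countable_coproducts C \<I>"
    and coprod: "\<forall>A :: nat \<Rightarrow> 'o. (\<forall>s. A s \<in> Obj C) \<longrightarrow> (\<exists>Q \<iota>. is_coproduct C UNIV A Q \<iota>)"
    and f: "\<And>s. f s \<in> \<I>" "\<And>s. f s \<in> Hom C (x s) (x (Suc s))"
    and y: "\<And>s. y s \<in> Hom C (x s) Y" "\<And>s. y (Suc s) \<cdot> f s = y s"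
  shows "y s = zero_arr C (x s) Y"
proof -
  have x: "x s \<in> Obj C" and Y: "Y \<in> Obj C" for s
    using Hom_Obj[OF y(1)] by auto
  obtain Q \<iota> where Q: "is_coproduct C UNIV x Q \<iota>"
    using coprod x by blast
  obtain R \<kappa> where R: "is_coproduct C UNIV (\<lambda>s. x (Suc s)) R \<kappa>"
    using coprod[THEN spec[of _ "\<lambda>s. x (Suc s)"]] x by blast
  have \<iota>: "\<iota> s \<in> Hom C (x s) Q" and \<kappa>: "\<kappa> s \<in> Hom C (x (Suc s)) R" for s
    using Q R by (auto simp: is_coproduct_def)
  have QO: "Q \<in> Obj C" and RO: "R \<in> Obj C"
    using Q R by (auto simp: is_coproduct_def)
  have Q_ex: "\<exists>h \<in> Hom C Q T. \<forall>s. h \<cdot> \<iota> s = g s"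
    if "T \<in> Obj C" "\<And>s. g s \<in> Hom C (x s) T" for T g
    using ex1_implies_ex[OF coproduct_ex1[OF Q that]] by auto
  obtain h where h: "h \<in> Hom C Q R" "\<And>s. h \<cdot> \<iota> s = \<kappa> s \<cdot> f s"
    using Q_ex[OF RO comp_Hom[OF f(2) \<kappa>]] by blast
  obtain e where e: "e \<in> Hom C R Q" "\<And>s. e \<cdot> \<kappa> s = \<iota> (Suc s)"
    using ex1_implies_ex[OF coproduct_ex1[OF R QO \<iota>]] by auto
  have "h \<in> \<I>"
    by (rule closed[unfolded closed_under_countable_coproducts_def, THEN spec[of _ UNIV],
          THEN spec[of _ f], THEN spec[of _ Q], THEN spec[of _ \<iota>], THEN spec[of _ R],
          THEN spec[of _ \<kappa>], THEN spec[of _ h], THEN mp])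
      (use Q R h f(1) HomD(2,3)[OF f(2)] in simp)
  \<comment> \<open>The map \<open>h\<close> is the coproduct of the \<open>f\<^sub>s\<close>; \<open>e\<close> moves the summand \<open>x\<^sub>s\<^sub>+\<^sub>1\<close> of \<open>R\<close> into \<open>Q\<close>.\<close>
  define \<sigma> where "\<sigma> = e \<cdot> h"
  have \<sigma>: "\<sigma> \<in> Hom C Q Q" "\<sigma> \<in> \<I>"
    unfolding \<sigma>_def using comp_Hom[OF h(1) e(1)] I_postcomp[OF \<open>h \<in> \<I>\<close> h(1) e(1)] .
  have \<sigma>_\<iota>: "\<sigma> \<cdot> \<iota> s = \<iota> (Suc s) \<cdot> f s" for s
  proof -
    have "\<sigma> \<cdot> \<iota> s = e \<cdot> (\<kappa> s \<cdot> f s)"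
      unfolding \<sigma>_def using comp_assoc[OF \<iota> h(1) e(1)] h(2) by simp
    then show ?thesis
      using comp_assoc[OF f(2) \<kappa> e(1)] e(2) by simp
  qed
  define \<theta> where "\<theta> = add_arr C (id_arr C Q) (neg_arr C \<sigma>)"
  have n\<sigma>: "neg_arr C \<sigma> \<in> Hom C Q Q" and idQ: "id_arr C Q \<in> Hom C Q Q"
    using neg_Hom[OF \<sigma>(1)] id_Hom[OF QO] .
  have \<theta>: "\<theta> \<in> Hom C Q Q"
    unfolding \<theta>_def using add_Hom[OF idQ n\<sigma>] .
  have add_zero: "add_arr C g (neg_arr C (zero_arr C A B)) = g" if "g \<in> Hom C A B" for g A B
    using monoid.r_one[OF group.is_monoid[OF comm_group.axioms(2)[OF Hom_comm_group[OF that]]], of g]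
      that neg_zero Hom_Obj[OF that] by simp
  have \<theta>_P: "\<theta> \<cdot> g = g" if P: "P \<in> \<P>" and g: "g \<in> Hom C P Q" for P g
    unfolding \<theta>_def comp_add_left[OF g idQ n\<sigma>]
    using neg_comp[OF g \<sigma>(1)] I_comp_P[OF \<sigma>(2,1) P g] id_left[OF g] add_zero[OF g] by simp
  have s\<theta>_P: "susp_arr C \<theta> \<cdot> g = g" if P: "P \<in> \<P>" and g: "g \<in> Hom C P (susp_obj C Q)" for P g
  proof -
    have "susp_arr C \<theta> = add_arr C (id_arr C (susp_obj C Q)) (neg_arr C (susp_arr C \<sigma>))"
      unfolding \<theta>_def using susp_add[OF idQ n\<sigma>] susp_id[OF QO] susp_neg[OF \<sigma>(1)] by simp
    then show ?thesis
      using comp_add_left[OF g id_Hom[OF susp_Obj[OF QO]] neg_Hom[OF susp_Hom[OF \<sigma>(1)]]]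
        neg_comp[OF g susp_Hom[OF \<sigma>(1)]] I_comp_P[OF susp_I[OF \<sigma>(2)] susp_Hom[OF \<sigma>(1)] P g]
        id_left[OF g] add_zero[OF g] by simp
  qed
  obtain v w where tri: "(\<theta>, v, w) \<in> Tri C"
    using TR1_cone[OF HomD(1)[OF \<theta>]] by blast
  obtain T where v: "v \<in> Hom C Q T"
    using triangleE[OF tri] HomD(2,3)[OF \<theta>] HomD(2,3) by metis
  have w: "w \<in> Hom C T (susp_obj C Q)"
    using triangle_Hom[OF tri \<theta> v] .
  have TO: "T \<in> Obj C"
    using Hom_Obj[OF v] by simp
  have "zero_object C T"
  proof (rule zero_object_if_no_maps_from_P[OF gen TO])
    fix P k assume P: "P \<in> \<P>" and k: "k \<in> Hom C P T"
    have s\<theta>: "susp_arr C \<theta> \<in> Hom C (susp_obj C Q) (susp_obj C Q)"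
      using susp_Hom[OF \<theta>] .
    have "neg_arr C (susp_arr C \<theta>) \<cdot> w = zero_arr C T (susp_obj C Q)"
      using triangle_comp_zero[OF rotate[OF rotate[OF tri]] w neg_Hom[OF s\<theta>]] .
    then have "susp_arr C \<theta> \<cdot> w = zero_arr C T (susp_obj C Q)"
      using neg_comp[OF w s\<theta>] neg_eq_zero_iff[OF comp_Hom[OF w s\<theta>]] by simp
    then have "w \<cdot> k = zero_arr C P (susp_obj C Q)"
      using s\<theta>_P[OF P comp_Hom[OF k w]] comp_assoc[OF k w s\<theta>] zero_comp[OF k] susp_Obj[OF QO] by simp
    then obtain g where g: "g \<in> Hom C P Q" "k = v \<cdot> g"
      using weak_kernel[OF rotate[OF tri] v w k] by blast
    then have "k = (v \<cdot> \<theta>) \<cdot> g"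
      using \<theta>_P[OF P g(1)] comp_assoc[OF g(1) \<theta> v] by simp
    then show "k = zero_arr C P T"
      using triangle_comp_zero[OF tri \<theta> v] zero_comp[OF g(1) TO] by simp
  qed
  obtain z where z: "z \<in> Hom C Q Y" "\<And>s. z \<cdot> \<iota> s = y s"
    using Q_ex[OF Y y(1)] by blast
  have "z \<cdot> \<sigma> = z"
  proof (rule coproduct_eqI[OF Q comp_Hom[OF \<sigma>(1) z(1)] z(1)])
    fix s
    have "(z \<cdot> \<sigma>) \<cdot> \<iota> s = z \<cdot> (\<iota> (Suc s) \<cdot> f s)"
      using comp_assoc[OF \<iota> \<sigma>(1) z(1)] \<sigma>_\<iota> by simp
    also have "\<dots> = z \<cdot> \<iota> s"
      using comp_assoc[OF f(2) \<iota> z(1)] z(2) y(2) by simp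
    finally show "(z \<cdot> \<sigma>) \<cdot> \<iota> s = z \<cdot> \<iota> s" .
  qed
  then have "z \<cdot> \<theta> = add_arr C z (neg_arr C z)"
    unfolding \<theta>_def comp_add_right[OF idQ n\<sigma> z(1)]
    using id_right[OF z(1)] comp_neg[OF \<sigma>(1) z(1)] by simp
  also have "\<dots> = zero_arr C Q Y"
    using group.r_inv[OF comm_group.axioms(2)[OF Hom_comm_group[OF z(1)]], of z] z(1)
    by (simp add: inv_hom_group)
  finally obtain z' where "z' \<in> Hom C T Y" "z = z' \<cdot> v"
    using weak_cokernel[OF tri \<theta> v z(1)] by blast
  then have "z = zero_arr C Q Y"
    using Hom_from_zero[OF \<open>zero_object C T\<close>] zero_comp[OF v Y] by simp
  then show ?thesis
    using z(2) zero_comp[OF \<iota> Y] by metis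
qed

text \<open>
  The filtration stage \<open>n\<close> of \<open>Hom(X, X\<^sub>n)\<close> contains the composite \<open>X \<rightarrow> X\<^sub>n\<close>, as the image of the
  identity of \<open>X\<^sub>n\<close>.
\<close>

lemma res_comp_zero_if_collapses:
  assumes gen: "generates C \<P>" and closed: "closed_under_countable_coproducts C \<I>"
    and coprod: "\<forall>A :: nat \<Rightarrow> 'o. (\<forall>s. A s \<in> Obj C) \<longrightarrow> (\<exists>Q \<iota>. is_coproduct C UNIV A Q \<iota>)"
    and R: "adams_resolution C \<P> \<I> X R"
    and collapses: "collapses_in_rows C R (res_obj R n) n"
  shows "res_comp C R 0 n = zero_arr C X (res_obj R n)"
proof -
  let ?Y = "res_obj R n" and ?K = "adams_couple C R (res_obj R n)"
  note tri = resolution_triangle[OF R]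
  have obj: "res_obj R k \<in> Obj C" for k
    using Hom_Obj[OF tri(4)] by blast
  interpret exact_couple ?K
    using adams_couple_exact[OF R obj] .
  have shift_0: "shift_obj C 0 A = A" "shift_arr C 0 f = f" for A f
    by (simp_all add: shift_obj_def shift_arr_def)
  have "filtration ?K n 0 = {\<one>\<^bsub>Dgrp ?K 0 0\<^esub>}"
  proof (rule filtration_vanishes)
    show "page_eq_page_inf ?K (n + 1)" "concentrated_in_first_rows ?K (n + 1) n"
      using collapses by (simp_all add: collapses_in_rows_def)
    fix y assume y: "\<And>s. y s \<in> carrier (Dgrp ?K s 0)" "\<And>s. imap ?K s 0 (y (Suc s)) = y s"
    have "y 0 = zero_arr C (res_obj R 0) ?Y"
    proof (rule compatible_maps_vanish[OF gen closed coprod, where f = "res_map R"])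
      show "y s \<in> Hom C (res_obj R s) ?Y" "y (Suc s) \<cdot> res_map R s = y s" for s
        using y[of s] by (simp_all add: adams_couple_def shift_0)
    qed (rule tri)+
    then show "y 0 = \<one>\<^bsub>Dgrp ?K 0 0\<^esub>"
      by (simp add: adams_couple_def shift_0)
  qed
  moreover have "iter_i ?K n 0 0 (id_arr C ?Y) \<in> filtration ?K n 0"
    unfolding filtration_def using id_Hom[OF obj] by (simp add: adams_couple_def shift_0)
  moreover have "iter_i ?K n 0 0 (id_arr C ?Y) = res_comp C R 0 n"
    using iter_i_adams_couple[OF R, of "id_arr C ?Y" 0 0 n ?Y] id_Hom[OF obj[of n]]
      id_left[OF res_comp_Hom[OF R, of 0 n]] by (simp add: shift_0)
  ultimately show ?thesis
    using tri(1) by (simp add: adams_couple_def shift_0)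
qed

end

lemma countable_coproducts:
  assumes inf: "infinite (UNIV :: 'i set)" and coprod: "has_coproducts TYPE('i) C"
  shows "\<forall>A :: nat \<Rightarrow> _. (\<forall>s. A s \<in> Obj C) \<longrightarrow> (\<exists>Q \<iota>. is_coproduct C UNIV A Q \<iota>)"
proof (intro allI impI)
  fix A :: "nat \<Rightarrow> _" assume A: "\<forall>s. A s \<in> Obj C"
  obtain e :: "nat \<Rightarrow> 'i" where e: "inj e"
    using infinite_countable_subset[OF inf] by blast
  obtain Q \<iota> where Q: "is_coproduct C (range e) (\<lambda>i. A (inv_into UNIV e i)) Q \<iota>"
    using coprod[unfolded has_coproducts_def, THEN spec[of _ "range e"],
        THEN spec[of _ "\<lambda>i. A (inv_into UNIV e i)"], THEN mp] A by blast
  have "is_coproduct C UNIV A Q (\<lambda>s. \<iota> (e s))"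
    unfolding is_coproduct_def
  proof (intro conjI ballI allI impI)
    show "Q \<in> Obj C"
      using Q by (simp add: is_coproduct_def)
    show "\<iota> (e s) \<in> Hom C (A s) Q" for s
      using Q e by (auto simp: is_coproduct_def)
    fix T g assume T: "T \<in> Obj C" and g: "\<forall>s \<in> UNIV. g s \<in> Hom C (A s) T"
    have "\<exists>!h. h \<in> Hom C Q T \<and> (\<forall>i \<in> range e. h \<cdot>\<^bsub>C\<^esub> \<iota> i = g (inv_into UNIV e i))"
      using g by (intro coproduct_ex1[OF Q T]) blast
    then show "\<exists>!h. h \<in> Hom C Q T \<and> (\<forall>s \<in> UNIV. h \<cdot>\<^bsub>C\<^esub> \<iota> (e s) = g s)"
      using e by simp
  qed
  then show "\<exists>Q \<iota>. is_coproduct C UNIV A Q \<iota>" by blast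
qed

section \<open>Length and the collapse of the Adams spectral sequence\<close>

theorem proposition4p5:
  fixes S :: "('o, 'm, 'z) triangulated_scheme"
    and \<P> :: "'o set" and \<I> :: "'m set" and X :: 'o and n :: nat
  assumes triangulated: "triangulated_category S"
    and infinite_index: "infinite (UNIV :: 'i set)"
    and coproducts: "has_coproducts TYPE('i) S"
    and proj_class: "projective_class S \<P> \<I>"
    and stable: "stable_class S \<P> \<I>"
    and X: "X \<in> Obj S"
  shows "(length_at_most S \<P> X n \<longrightarrow>
            (\<exists>R. adams_resolution S \<P> \<I> X R \<and> (\<forall>Y \<in> Obj S. collapses_in_rows S R Y n)) \<and>
            (0 < n \<longrightarrow> (\<forall>R. adams_resolution S \<P> \<I> X R \<longrightarrow>
               (\<forall>Y \<in> Obj S. collapses_in_rows S R Y n)))) \<and>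
         (generates S \<P> \<and> closed_under_countable_coproducts S \<I> \<longrightarrow>
            (\<forall>R. adams_resolution S \<P> \<I> X R \<longrightarrow>
               ((\<forall>Y \<in> Obj S. collapses_in_rows S R Y n) \<longrightarrow> length_at_most S \<P> X n) \<and>
               (length_at_most S \<P> X n \<longrightarrow>
                  (\<forall>Y \<in> Obj S. converges_strongly (adams_couple S R Y)))))"
proof -
  interpret stable_projective_class S \<P> \<I>
    using triangulated proj_class stable
    by (simp add: stable_projective_class_def stable_projective_class_axioms_def)
  have collapse: "\<forall>Y \<in> Obj S. collapses_in_rows S R Y n"
    if "X \<in> length_class S \<P> n" "0 < n" "adams_resolution S \<P> \<I> X R" for R
    using that collapses_in_rows_if_res_comp_zero(1) res_comp_zero_if_length by blast
  have ex: "\<exists>R. adams_resolution S \<P> \<I> X R \<and> (\<forall>Y \<in> Obj S. collapses_in_rows S R Y n)"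
    if length: "X \<in> length_class S \<P> n"
  proof (cases "n = 0")
    case True
    then have zero: "zero_object S X"
      using length by simp
    then obtain R where R: "adams_resolution S \<P> \<I> X R" "\<And>s. res_obj R s = X"
      using zero_object_resolution by blast
    have "res_comp S R s n = zero_arr S (res_obj R s) (res_obj R (s + n))" for s
      using Hom_to_zero[OF zero] res_comp_Hom[OF R(1), of s n] R(2) by simp
    then show ?thesis
      using collapses_in_rows_if_res_comp_zero(1)[OF R(1)] R(1) by blast
  next
    case False
    then show ?thesis
      using collapse[OF length] ex_adams_resolution[OF X] by blast
  qed
  have conv: "converges_strongly (adams_couple S R Y)"
    if length: "X \<in> length_class S \<P> n" and R: "adams_resolution S \<P> \<I> X R" and Y: "Y \<in> Obj S" for R Y
  proof -
    obtain m where "0 < m" "X \<in> length_class S \<P> m"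
      using length_class_positive[OF length] by blast
    then show ?thesis
      using collapses_in_rows_if_res_comp_zero(2)[OF R Y] res_comp_zero_if_length[OF R] by blast
  qed
  have converse: "X \<in> length_class S \<P> n"
    if "generates S \<P>" "closed_under_countable_coproducts S \<I>"
      and R: "adams_resolution S \<P> \<I> X R" and collapses: "\<forall>Y \<in> Obj S. collapses_in_rows S R Y n" for R
  proof -
    have "collapses_in_rows S R (res_obj R n) n"
      using collapses Hom_Obj[OF resolution_triangle(4)[OF R]] by blast
    then show ?thesis
      using length_if_res_comp_zero[OF R X] that(1,2) R
        res_comp_zero_if_collapses[OF _ _ countable_coproducts[OF infinite_index coproducts]]
      by blast
  qed
  show ?thesis
    unfolding length_at_most_def using ex collapse conv converse by blast
qed

end
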